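(* The set of functionals $(S,Q)\mapsto\log f_\alpha(S,Q)$, where $f_\alpha$ ranges over $\Delta(\mathcal{A},\le)$ (with $f\in\Delta(\mathcal{G},\le)$, $\alpha\ge1$), is convex under pointwise convex combinations. Explicitly: if $f_\alpha,g_\beta\in\Delta(\mathcal{A},\le)$, $\lambda\in[0,1]$, $h\in\Delta(\mathcal{G},\le)$ satisfies $\log h(G,P)=\lambda\log f(G,P)+(1-\lambda)\log g(G,P)$ for all nonempty graphs $G$ and $P\in\mathcal{P}(V(G))$, and $\gamma=\lambda\alpha+(1-\lambda)\beta$, then $h_\gamma\in\Delta(\mathcal{A},\le)$.
   Context: Graphs are finite simple undirected; $x\simeq x'$ means equal or adjacent. Strong product $G\boxtimes H$: $(g,h)\simeq(g',h')$ iff $g\simeq g'$ and $h\simeq h'$. $H\le G$ for graphs means a homomorphism $\overline{H}\to\overline{G}$ exists. $\Delta(\mathcal{G},\le)$: maps from graphs to $\mathbb{R}_{\ge0}$, $0$ on the empty graph, $1$ on $K_1$, additive under disjoint union, multiplicative under $\boxtimes$, monotone under $\le$. Probabilistic refinement: for a finite set $X$, $\mathcal{P}(X)$ is the set of probability distributions on $X$ and $\mathcal{P}_n(X)$ the set of $n$-types; for $Q\in\mathcal{P}_n(V(G))$, $G^{n}_{Q}$ is the subgraph of $G^{\boxtimes n}$ induced on the type class of $Q$ (sequences in $V(G)^n$ with empirical distribution $Q$). For $f\in\Delta(\mathcal{G},\le)$, nonempty $G$ and $Q\in\mathcal{P}(V(G))$, $f(G,Q)=\lim_{n}\sqrt[n]{f(G^{n}_{Q_n})}$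 for any sequence $Q_n\in\mathcal{P}_n(V(G))$, $Q_n\to Q$ (this limit exists and is independent of the sequence). A noncommutative graph is a subspace $S\subseteq B(\mathcal{H})$ ($\mathcal{H}$ finite-dimensional) with $I\in S$, $S^*=S$. A cohomomorphism from $T\subseteq B(\mathcal{K})$ to $S\subseteq B(\mathcal{H})$ is a finite family of linear maps $E_i:\mathcal{K}\to\mathcal{H}$ with $\sum_iE_i^*E_i=I$ and $E_i^*SE_j\subseteq T$ for all $i,j$; $T\le S$ if one exists. $\widehat{G}=\operatorname{span}\{|x\rangle\langle x'|:x\simeq x'\}\subseteq B(\mathbb{C}^{V(G)})$, $\mathcal{C}_d=\mathbb{C}I\subseteq B(\mathbb{C}^d)$. $\mathcal{A}$ is the semiring (under $\oplus,\otimes$, up to unitary isomorphism) generated by all $\widehat{G}$ and $\mathcal{C}_d$; its elements have the form $S=\bigoplus_{d=1}^r\widehat{G_d}\otimes\mathcal{C}_d$. For $f\in\Delta(\mathcal{G},\le)$, $\alpha\ge1$, $f_\alpha(S)=\sum_d f(G_d)d^\alpha$. $\Delta(\mathcal{A},\le)$ is the set of $\le$-monotone semiring homomorphisms $\mathcal{A}\to\mathbb{R}_{\ge0}$. For such $S$, let $\pi:\bigsqcup_dV(G_d)\to\{1,\dots,r\}$ send $g\in V(G_d)$ to $d$; for $Q\in\mathcal{P}(\bigsqcup_dV(G_d))$, let $Q_d$ be the normalized restriction of $Q$ to $V(G_d)$, and define $\log f_\alpha(S,Q)=H(\pi_*Q)+\sum_{d=1}^r\pi_*Q(d)\left[\log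 f(G_d,Q_d)+\alpha\log d\right]$, where $H$ is Shannon entropy and terms with $\pi_*Q(d)=0$ are omitted. *)

theory Defs
  imports "Jordan_Normal_Form.Schur_Decomposition" Complex_Main
begin

text \<open>A graph is a pair (n, E): vertex set {0..<n}, adjacency E (symmetric, irreflexive,
  supported on the vertex set).  Functions on graphs are compared only on well-formed graphs.\<close>

type_synonym graph = "nat \<times> (nat \<Rightarrow> nat \<Rightarrow> bool)"

definition nv :: "graph \<Rightarrow> nat" where "nv G = fst G"
definition adj :: "graph \<Rightarrow> nat \<Rightarrow> nat \<Rightarrow> bool" where "adj G = snd G"

definition wf_graph :: "graph \<Rightarrow> bool" where
  "wf_graph G \<longleftrightarrow> (\<forall>i j. adj G i j \<longrightarrow> i < nv G \<and> j < nv G) \<and>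
                  (\<forall>i j. adj G i j \<longrightarrow> adj G j i) \<and> (\<forall>i. \<not> adj G i i)"

definition simeq :: "graph \<Rightarrow> nat \<Rightarrow> nat \<Rightarrow> bool" where
  "simeq G x y \<longleftrightarrow> x = y \<or> adj G x y"

definition empty_graph :: graph where "empty_graph = (0, \<lambda>_ _. False)"
definition K1 :: graph where "K1 = (1, \<lambda>_ _. False)"

definition dunion :: "graph \<Rightarrow> graph \<Rightarrow> graph" where
  "dunion G H = (nv G + nv H, \<lambda>i j. (i < nv G \<and> j < nv G \<and> adj G i j) \<or>
       (nv G \<le> i \<and> nv G \<le> j \<and> adj H (i - nv G) (j - nv G)))"

text \<open>Strong product; vertex (g,h) is encoded as g * nv H + h.\<close>
definition sprod :: "graph \<Rightarrow> graph \<Rightarrow> graph" where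
  "sprod G H = (nv G * nv H, \<lambda>i j. i < nv G * nv H \<and> j < nv G * nv H \<and> i \<noteq> j \<and>
       simeq G (i div nv H) (j div nv H) \<and> simeq H (i mod nv H) (j mod nv H))"

definition graph_le :: "graph \<Rightarrow> graph \<Rightarrow> bool" where
  "graph_le H G \<longleftrightarrow> (\<exists>\<phi>. (\<forall>x<nv H. \<phi> x < nv G) \<and>
      (\<forall>x<nv H. \<forall>y<nv H. x \<noteq> y \<and> \<not> adj H x y \<longrightarrow> \<phi> x \<noteq> \<phi> y \<and> \<not> adj G (\<phi> x) (\<phi> y)))"

definition DeltaG :: "(graph \<Rightarrow> real) \<Rightarrow> bool" where
  "DeltaG f \<longleftrightarrow> (\<forall>G. wf_graph G \<longrightarrow> f G \<ge> 0) \<and> f empty_graph = 0 \<and> f K1 = 1 \<and>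
     (\<forall>G H. wf_graph G \<longrightarrow> wf_graph H \<longrightarrow> f (dunion G H) = f G + f H) \<and>
     (\<forall>G H. wf_graph G \<longrightarrow> wf_graph H \<longrightarrow> f (sprod G H) = f G * f H) \<and>
     (\<forall>G H. wf_graph G \<longrightarrow> wf_graph H \<longrightarrow> graph_le H G \<longrightarrow> f H \<le> f G)"

text \<open>Canonical copy (on {0..<card V}) of a graph with finite vertex set V and adjacency R,
  via an arbitrary bijection (functions in Delta(G,\<le>) are isomorphism invariant).\<close>
definition canon :: "'a set \<Rightarrow> ('a \<Rightarrow> 'a \<Rightarrow> bool) \<Rightarrow> graph" where
  "canon V R = (let b = (SOME b. bij_betw b {0..<card V} V) in
     (card V, \<lambda>i j. i < card V \<and> j < card V \<and> R (b i) (b j)))"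

text \<open>Probability distributions on V(G) = {0..<n} (values outside V(G) are irrelevant).\<close>
definition pdist :: "nat \<Rightarrow> (nat \<Rightarrow> real) \<Rightarrow> bool" where
  "pdist n Q \<longleftrightarrow> (\<forall>v<n. Q v \<ge> 0) \<and> (\<Sum>v<n. Q v) = 1"

definition ntype :: "nat \<Rightarrow> nat \<Rightarrow> (nat \<Rightarrow> real) \<Rightarrow> bool" where
  "ntype k n Q \<longleftrightarrow> pdist k Q \<and> (\<forall>v<k. \<exists>m::nat. real n * Q v = real m)"

text \<open>G^n_Q: subgraph of the n-th strong power induced on the type class of Q.\<close>
definition type_graph :: "graph \<Rightarrow> nat \<Rightarrow> (nat \<Rightarrow> real) \<Rightarrow> graph" where
  "type_graph G n Q = canon
     {xs. length xs = n \<and> set xs \<subseteq> {0..<nv G} \<and>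
          (\<forall>v<nv G. real (count_list xs v) = real n * Q v)}
     (\<lambda>xs ys. xs \<noteq> ys \<and> (\<forall>k<n. simeq G (xs ! k) (ys ! k)))"

definition type_seq :: "graph \<Rightarrow> (nat \<Rightarrow> real) \<Rightarrow> nat \<Rightarrow> nat \<Rightarrow> real" where
  "type_seq G Q = (SOME s. (\<forall>n\<ge>1. ntype (nv G) n (s n)) \<and>
                            (\<forall>v<nv G. (\<lambda>n. s n v) \<longlonglongrightarrow> Q v))"

definition prob_ref :: "(graph \<Rightarrow> real) \<Rightarrow> graph \<Rightarrow> (nat \<Rightarrow> real) \<Rightarrow> real" where
  "prob_ref f G Q = lim (\<lambda>n. root n (f (type_graph G n (type_seq G Q n))))"

text \<open>Cohomomorphism from T \<subseteq> B(C^k) to S \<subseteq> B(C^m): Kraus operators E_i : C^k \<rightarrow> C^m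
  with sum E_i^* E_i = I and E_i^* S E_j \<subseteq> T.\<close>
definition cohom :: "nat \<Rightarrow> complex mat set \<Rightarrow> nat \<Rightarrow> complex mat set \<Rightarrow> bool" where
  "cohom k T m S \<longleftrightarrow> (\<exists>Es :: complex mat list.
      (\<forall>E\<in>set Es. E \<in> carrier_mat m k) \<and>
      foldr (+) (map (\<lambda>E. mat_adjoint E * E) Es) (0\<^sub>m k k) = 1\<^sub>m k \<and>
      (\<forall>Ei\<in>set Es. \<forall>Ej\<in>set Es. \<forall>X\<in>S. mat_adjoint Ei * X * Ej \<in> T))"

text \<open>An element S = (+)_{d=1}^r hat(G_d) (x) C_d of A is represented by the list
  Gs = [G_1, ..., G_r].  Basis of the underlying Hilbert space:
  triples (d, v, k) with v \<in> V(G_d), k < d, ordered blockwise in d and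
  lexicographically in (v,k) (Kronecker ordering of C^{V(G_d)} \<otimes> C^d).\<close>
definition gr :: "graph list \<Rightarrow> nat \<Rightarrow> graph" where
  "gr Gs d = (if 1 \<le> d \<and> d \<le> length Gs then Gs ! (d - 1) else empty_graph)"

definition idxs :: "graph list \<Rightarrow> (nat \<times> nat \<times> nat) list" where
  "idxs Gs = concat (map (\<lambda>d. concat (map (\<lambda>v. map (\<lambda>k. (d, v, k)) [0..<d])
                                            [0..<nv (gr Gs d)])) [1..<length Gs + 1])"

definition ncdim :: "graph list \<Rightarrow> nat" where "ncdim Gs = length (idxs Gs)"

text \<open>The matrix of (+)_d (M_d \<otimes> I_d) where M_d = sum c_d(v,v') |v><v'| over v \<simeq> v' in G_d.\<close>
definition ncmat :: "graph list \<Rightarrow> (nat \<Rightarrow> nat \<Rightarrow> nat \<Rightarrow> complex) \<Rightarrow> complex mat" where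
  "ncmat Gs c = mat (ncdim Gs) (ncdim Gs) (\<lambda>(p, q).
     (case (idxs Gs ! p, idxs Gs ! q) of ((d, v, k), (d', v', k')) \<Rightarrow>
        if d = d' \<and> k = k' \<and> simeq (gr Gs d) v v' then c d v v' else 0))"

definition ncg :: "graph list \<Rightarrow> complex mat set" where
  "ncg Gs = range (ncmat Gs)"

definition ncg_le :: "graph list \<Rightarrow> graph list \<Rightarrow> bool" where
  "ncg_le Ts Ss \<longleftrightarrow> cohom (ncdim Ts) (ncg Ts) (ncdim Ss) (ncg Ss)"

text \<open>Semiring operations on representatives (up to unitary isomorphism):
  blocks with equal d add by disjoint union; (G (x) C_a) (x) (H (x) C_b) = (G \<boxtimes> H) (x) C_{ab}.\<close>
definition rep_add :: "graph list \<Rightarrow> graph list \<Rightarrow> graph list" where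
  "rep_add Gs Hs = map (\<lambda>d. dunion (gr Gs d) (gr Hs d)) [1..<max (length Gs) (length Hs) + 1]"

definition rep_mult :: "graph list \<Rightarrow> graph list \<Rightarrow> graph list" where
  "rep_mult Gs Hs = map (\<lambda>d. foldr dunion
       (map (\<lambda>(a, b). sprod (gr Gs a) (gr Hs b))
            (filter (\<lambda>(a, b). a * b = d) (List.product [1..<length Gs + 1] [1..<length Hs + 1])))
       empty_graph) [1..<length Gs * length Hs + 1]"

definition wf_rep :: "graph list \<Rightarrow> bool" where
  "wf_rep Gs \<longleftrightarrow> (\<forall>G\<in>set Gs. wf_graph G)"

definition DeltaA :: "(graph list \<Rightarrow> real) \<Rightarrow> bool" where
  "DeltaA F \<longleftrightarrow> (\<forall>Gs. wf_rep Gs \<longrightarrow> F Gs \<ge> 0) \<and> F [] = 0 \<and> F [K1] = 1 \<and>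
     (\<forall>Gs Hs. wf_rep Gs \<longrightarrow> wf_rep Hs \<longrightarrow> F (rep_add Gs Hs) = F Gs + F Hs) \<and>
     (\<forall>Gs Hs. wf_rep Gs \<longrightarrow> wf_rep Hs \<longrightarrow> F (rep_mult Gs Hs) = F Gs * F Hs) \<and>
     (\<forall>Gs Hs. wf_rep Gs \<longrightarrow> wf_rep Hs \<longrightarrow> ncg_le Gs Hs \<longrightarrow> F Gs \<le> F Hs)"

definition falpha :: "(graph \<Rightarrow> real) \<Rightarrow> real \<Rightarrow> graph list \<Rightarrow> real" where
  "falpha f \<alpha> Gs = (\<Sum>i<length Gs. f (Gs ! i) * real (i + 1) powr \<alpha>)"

end

theory Submission
  imports Defs
begin

text \<open>
  Regard \<open>S = \<Oplus> G_d \<otimes> C_d\<close> as the coloured graph \<open>U = \<Squnion> G_d\<close>, the colour \<open>d\<close> being a fibre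
  dimension.  All sequences of a type class \<open>a\<close> of \<open>U\<close> have the same total dimension
  \<open>D(a) = \<Prod> d(v)^a(v)\<close>, so the corresponding part of \<open>S^n\<close> is the single block \<open>U^n_a \<otimes> C_D(a)\<close>, and
  \<open>f_\<alpha>(S)^n\<close> agrees with \<open>max_a f(U^n_a) D(a)^\<alpha>\<close> up to a factor polynomial in \<open>n\<close>.

  Given a cohomomorphism from \<open>T\<close> to \<open>S\<close>, choose for every vertex \<open>v\<close> of \<open>T\<close> one Kraus operator and one
  vertex \<open>\<phi>(v)\<close> of \<open>S\<close> whose common block is nonzero.  This block is a multiple of an isometry and, after
  rescaling, the chosen blocks form a cohomomorphism on their own.  Its tensor powers send the type class
  \<open>a\<close> to the type class \<open>\<phi>_* a\<close>; so \<open>f(T,a) D(a)^\<alpha> \<le> f(S,\<phi>_* a) D(\<phi>_* a)^\<alpha>\<close> asymptotically, with the same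
  \<open>\<phi>_* a\<close> for all monotone \<open>f_\<alpha>\<close>.  Logarithms of these inequalities can be averaged, and the averaged
  inequality over all \<open>a\<close> gives monotonicity of \<open>h_\<gamma>\<close>.
\<close>

section \<open>Functionals on abstract graphs\<close>

text \<open>The hypothesis on h concerns only limits of n-th roots, so it gives no direct
  information about h on any single graph. Two facts lead from limits back to inequalities.
  Concatenation makes the values of type classes supermultiplicative, so by Fekete's lemma every
  single value, and not only the asymptotic one, is bounded by its exponential growth rate; and
  polynomial factors disappear under n-th roots. The obstacle is the boundary of the simplex: an
  arbitrary sequence of types can be squeezed between multiples of one limiting type only if the
  latter has full support. Therefore only types with all counts positive are compared, and the
  target is cut down to the image of \<phi>, where the pushed-forward type has full support again.
  For a general type every count is raised by 1; the resulting extra powers are subexponential. The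
  map \<phi> alone need not be monotone data between graphs: unrelated vertices may go to one vertex
  if their isometries have orthogonal ranges. What survives tensor powers is the system of overlaps
  of the isometries, and monotonicity of f_\<alpha> is applied to the single blocks built from
  it.\<close>

lemma nv_simps [simp]:
  "nv empty_graph = 0" "nv K1 = 1" "nv (dunion G H) = nv G + nv H" "nv (sprod G H) = nv G * nv H"
  by (simp_all add: nv_def empty_graph_def K1_def dunion_def sprod_def)

lemma adj_simps:
  "adj empty_graph i j \<longleftrightarrow> False" "adj K1 i j \<longleftrightarrow> False"
  "adj (dunion G H) i j \<longleftrightarrow> (i < nv G \<and> j < nv G \<and> adj G i j) \<or>
       (nv G \<le> i \<and> nv G \<le> j \<and> adj H (i - nv G) (j - nv G))"
  "adj (sprod G H) i j \<longleftrightarrow> i < nv G * nv H \<and> j < nv G * nv H \<and> i \<noteq> j \<and>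
       simeq G (i div nv H) (j div nv H) \<and> simeq H (i mod nv H) (j mod nv H)"
  by (simp_all add: adj_def empty_graph_def K1_def dunion_def sprod_def)

lemma symp_simeq: "wf_graph G \<Longrightarrow> symp (simeq G)"
  by (auto simp: symp_def simeq_def wf_graph_def)

lemma reflp_simeq: "reflp (simeq G)"
  by (auto simp: reflp_def simeq_def)

lemma wf_empty_graph [simp]: "wf_graph empty_graph" and wf_K1 [simp]: "wf_graph K1"
  by (simp_all add: wf_graph_def adj_simps)

lemma wf_dunion [simp]:
  assumes "wf_graph G" "wf_graph H"
  shows "wf_graph (dunion G H)"
  using assms by (fastforce simp: wf_graph_def adj_simps)

lemma wf_sprod [simp]:
  assumes "wf_graph G" "wf_graph H"
  shows "wf_graph (sprod G H)"
  using assms[THEN symp_simeq] by (auto simp: wf_graph_def adj_simps dest: sympD)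

lemma DeltaG_nonneg: "DeltaG f \<Longrightarrow> wf_graph G \<Longrightarrow> 0 \<le> f G"
  and DeltaG_empty: "DeltaG f \<Longrightarrow> f empty_graph = 0"
  and DeltaG_K1: "DeltaG f \<Longrightarrow> f K1 = 1"
  and DeltaG_dunion: "DeltaG f \<Longrightarrow> wf_graph G \<Longrightarrow> wf_graph H \<Longrightarrow> f (dunion G H) = f G + f H"
  and DeltaG_sprod: "DeltaG f \<Longrightarrow> wf_graph G \<Longrightarrow> wf_graph H \<Longrightarrow> f (sprod G H) = f G * f H"
  and DeltaG_mono: "DeltaG f \<Longrightarrow> wf_graph G \<Longrightarrow> wf_graph H \<Longrightarrow> graph_le H G \<Longrightarrow> f H \<le> f G"
  unfolding DeltaG_def by blast+

text \<open>Membership in Delta(G) gives isomorphism invariance only, and \<open>canon\<close>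
  relies on an unspecified bijection, so equations between graphs are replaced by two graphs
  presenting the same structure. \<open>R\<close> stands for "equal or adjacent", the relation
  through which strong products are formed.\<close>

definition presents :: "graph \<Rightarrow> 'a set \<Rightarrow> ('a \<Rightarrow> 'a \<Rightarrow> bool) \<Rightarrow> bool" where
  "presents G V R \<longleftrightarrow> wf_graph G \<and> (\<exists>\<beta>. bij_betw \<beta> {0..<nv G} V \<and>
     (\<forall>i<nv G. \<forall>j<nv G. simeq G i j \<longleftrightarrow> R (\<beta> i) (\<beta> j)))"

lemma presents_wf: "presents G V R \<Longrightarrow> wf_graph G"
  by (simp add: presents_def)

text \<open>The last premise is the contrapositive of a homomorphism of complements. Since the
  relations include equality, one implication says both that distinct nonadjacent vertices get
  distinct images and that these images are nonadjacent.\<close>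

lemma presents_mono:
  assumes "DeltaG f" "presents G V R" "presents H W R'"
    and "\<phi> ` V \<subseteq> W" "\<And>x y. x \<in> V \<Longrightarrow> y \<in> V \<Longrightarrow> R' (\<phi> x) (\<phi> y) \<Longrightarrow> R x y"
  shows "f G \<le> f H"
proof -
  obtain \<beta> where \<beta>: "bij_betw \<beta> {0..<nv G} V"
      "\<And>i j. i < nv G \<Longrightarrow> j < nv G \<Longrightarrow> simeq G i j \<longleftrightarrow> R (\<beta> i) (\<beta> j)"
    using assms(2) unfolding presents_def by blast
  obtain \<beta>' where \<beta>': "bij_betw \<beta>' {0..<nv H} W"
      "\<And>i j. i < nv H \<Longrightarrow> j < nv H \<Longrightarrow> simeq H i j \<longleftrightarrow> R' (\<beta>' i) (\<beta>' j)"
    using assms(3) unfolding presents_def by blast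
  define \<psi> where "\<psi> i = inv_into {0..<nv H} \<beta>' (\<phi> (\<beta> i))" for i
  have V: "\<beta> i \<in> V" if "i < nv G" for i
    using \<beta>(1) that by (auto simp: bij_betw_def)
  have W: "\<phi> (\<beta> i) \<in> \<beta>' ` {0..<nv H}" if "i < nv G" for i
    using V[OF that] assms(4) \<beta>'(1) by (auto simp: bij_betw_def)
  have \<psi>: "\<psi> i < nv H" "\<beta>' (\<psi> i) = \<phi> (\<beta> i)" if "i < nv G" for i
    using inv_into_into[OF W[OF that]] f_inv_into_f[OF W[OF that]] by (simp_all add: \<psi>_def)
  have "simeq G i j" if "i < nv G" "j < nv G" "simeq H (\<psi> i) (\<psi> j)" for i j
    using assms(5)[OF V V, of i j] that \<beta>(2) \<beta>'(2) \<psi> by auto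
  then have "graph_le G H"
    unfolding graph_le_def using \<psi>(1) by (intro exI[of _ \<psi>]) (auto simp: simeq_def)
  then show ?thesis
    by (rule DeltaG_mono[OF assms(1) presents_wf[OF assms(3)] presents_wf[OF assms(2)]])
qed

lemma presents_eq:
  assumes "DeltaG f" "presents G V R" "presents H V R"
  shows "f G = f H"
  by (rule antisym[OF presents_mono[OF assms, of id] presents_mono[OF assms(1,3,2), of id]]) simp_all

lemma presents_empty: "presents empty_graph {} R"
  unfolding presents_def by (auto simp: bij_betw_def)

lemma presents_K1: "reflp R \<Longrightarrow> presents K1 {x} R"
  unfolding presents_def by (auto simp: bij_betw_def reflp_def simeq_def intro!: exI[of _ "\<lambda>_. x"])

text \<open>Makes the bijection hidden in \<open>canon\<close> available. The conjunct
  \<open>x \<noteq> y\<close> turns a reflexive relation into an adjacency, and injectivity of the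
  bijection lets \<open>simeq\<close> recover \<open>R\<close>.\<close>

lemma canon_presentation:
  assumes "finite V" "reflp R" "symp R"
  shows "\<exists>\<beta>. bij_betw \<beta> {0..<card V} V \<and>
    (\<forall>i<card V. \<forall>j<card V. simeq (canon V (\<lambda>x y. x \<noteq> y \<and> R x y)) i j \<longleftrightarrow> R (\<beta> i) (\<beta> j)) \<and>
    nv (canon V (\<lambda>x y. x \<noteq> y \<and> R x y)) = card V \<and>
    wf_graph (canon V (\<lambda>x y. x \<noteq> y \<and> R x y))"
proof -
  define \<beta> where "\<beta> = (SOME b. bij_betw b {0..<card V} V)"
  have \<beta>: "bij_betw \<beta> {0..<card V} V"
    unfolding \<beta>_def using ex_bij_betw_nat_finite[OF assms(1)] by (rule someI_ex)
  let ?G = "canon V (\<lambda>x y. x \<noteq> y \<and> R x y)"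
  have nv: "nv ?G = card V"
    by (simp add: canon_def nv_def Let_def)
  have adj: "adj ?G i j \<longleftrightarrow> i < card V \<and> j < card V \<and> \<beta> i \<noteq> \<beta> j \<and> R (\<beta> i) (\<beta> j)" for i j
    by (simp add: canon_def adj_def Let_def \<beta>_def)
  have "simeq ?G i j \<longleftrightarrow> R (\<beta> i) (\<beta> j)" if "i < card V" "j < card V" for i j
    using that assms(2) bij_betw_imp_inj_on[OF \<beta>]
    by (auto simp: simeq_def adj reflp_def inj_on_def)
  moreover have "wf_graph ?G"
    using assms(3) by (auto simp: wf_graph_def adj nv symp_def)
  ultimately show ?thesis using \<beta> nv by blast
qed

lemma presents_canon:
  assumes "finite V" "reflp R" "symp R"
  shows "presents (canon V (\<lambda>x y. x \<noteq> y \<and> R x y)) V R"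
  using canon_presentation[OF assms] by (auto simp: presents_def)

lemma presents_dunion:
  assumes "presents G V R" "presents H W R" "V \<inter> W = {}"
    and "\<And>x y. x \<in> V \<Longrightarrow> y \<in> W \<Longrightarrow> \<not> R x y \<and> \<not> R y x"
  shows "presents (dunion G H) (V \<union> W) R"
proof -
  obtain \<beta> where \<beta>: "bij_betw \<beta> {0..<nv G} V"
      "\<And>i j. i < nv G \<Longrightarrow> j < nv G \<Longrightarrow> simeq G i j \<longleftrightarrow> R (\<beta> i) (\<beta> j)"
    using assms(1) unfolding presents_def by blast
  obtain \<beta>' where \<beta>': "bij_betw \<beta>' {0..<nv H} W"
      "\<And>i j. i < nv H \<Longrightarrow> j < nv H \<Longrightarrow> simeq H i j \<longleftrightarrow> R (\<beta>' i) (\<beta>' j)"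
    using assms(2) unfolding presents_def by blast
  define \<delta> where "\<delta> i = (if i < nv G then \<beta> i else \<beta>' (i - nv G))" for i
  have "bij_betw (\<lambda>i. i - nv G) {nv G..<nv G + nv H} {0..<nv H}"
    by (rule bij_betw_byWitness[where f' = "\<lambda>i. i + nv G"]) auto
  from bij_betw_trans[OF this \<beta>'(1)] have "bij_betw \<delta> {nv G..<nv G + nv H} W"
    by (subst bij_betw_cong[where g = "\<beta>' \<circ> (\<lambda>i. i - nv G)"]) (auto simp: \<delta>_def)
  moreover have "bij_betw \<delta> {0..<nv G} V"
    using \<beta>(1) by (subst bij_betw_cong[where g = \<beta>]) (auto simp: \<delta>_def)
  ultimately have "bij_betw \<delta> ({0..<nv G} \<union> {nv G..<nv G + nv H}) (V \<union> W)"
    using assms(3) by (intro bij_betw_combine) auto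
  then have bij: "bij_betw \<delta> {0..<nv (dunion G H)} (V \<union> W)"
    by (simp add: ivl_disj_un_two(3))
  have V: "\<beta> i \<in> V" if "i < nv G" for i
    using \<beta>(1) that by (auto simp: bij_betw_def)
  have W: "\<beta>' i \<in> W" if "i < nv H" for i
    using \<beta>'(1) that by (auto simp: bij_betw_def)
  have "simeq (dunion G H) i j \<longleftrightarrow> R (\<delta> i) (\<delta> j)"
    if "i < nv (dunion G H)" "j < nv (dunion G H)" for i j
  proof (cases "i < nv G"; cases "j < nv G")
    assume "i < nv G" "j < nv G"
    then show ?thesis using \<beta>(2)[of i j] by (auto simp: simeq_def adj_simps \<delta>_def)
  next
    assume "i < nv G" "\<not> j < nv G"
    then show ?thesis using assms(4)[OF V[of i] W[of "j - nv G"]] that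
      by (auto simp: simeq_def adj_simps \<delta>_def)
  next
    assume "\<not> i < nv G" "j < nv G"
    then show ?thesis using assms(4)[OF V[of j] W[of "i - nv G"]] that
      by (auto simp: simeq_def adj_simps \<delta>_def)
  next
    assume "\<not> i < nv G" "\<not> j < nv G"
    then show ?thesis using \<beta>'(2)[of "i - nv G" "j - nv G"] that
      by (auto simp: simeq_def adj_simps \<delta>_def less_diff_conv2)
  qed
  then show ?thesis
    using bij wf_dunion[OF assms(1,2)[THEN presents_wf]] unfolding presents_def by (intro conjI exI[of _ \<delta>]) auto
qed

lemma bij_betw_div_mod:
  "bij_betw (\<lambda>i. (i div n, i mod n)) {0..<m * n} ({0..<m} \<times> {0..<n::nat})"
proof (rule bij_betw_byWitness[where f' = "\<lambda>(q, r). q * n + r"])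
  show "(\<lambda>i. (i div n, i mod n)) ` {0..<m * n} \<subseteq> {0..<m} \<times> {0..<n}"
    by (auto simp: less_mult_imp_div_less intro!: mod_less_divisor) (metis gr0I mult_0_right not_less_zero)
  show "(\<lambda>(q, r). q * n + r) ` ({0..<m} \<times> {0..<n}) \<subseteq> {0..<m * n}"
  proof clarsimp
    fix q r assume "q < m" "r < n"
    then have "q * n + r < Suc q * n" by simp
    also have "\<dots> \<le> m * n" using \<open>q < m\<close> by (intro mult_le_mono1) simp
    finally show "q * n + r < m * n" .
  qed
qed auto

lemma presents_sprod:
  assumes "presents G V R" "presents H W S"
  shows "presents (sprod G H) (V \<times> W) (rel_prod R S)"
proof -
  obtain \<beta> where \<beta>: "bij_betw \<beta> {0..<nv G} V"
      "\<And>i j. i < nv G \<Longrightarrow> j < nv G \<Longrightarrow> simeq G i j \<longleftrightarrow> R (\<beta> i) (\<beta> j)"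
    using assms(1) unfolding presents_def by blast
  obtain \<beta>' where \<beta>': "bij_betw \<beta>' {0..<nv H} W"
      "\<And>i j. i < nv H \<Longrightarrow> j < nv H \<Longrightarrow> simeq H i j \<longleftrightarrow> S (\<beta>' i) (\<beta>' j)"
    using assms(2) unfolding presents_def by blast
  define \<delta> where "\<delta> = map_prod \<beta> \<beta>' \<circ> (\<lambda>i. (i div nv H, i mod nv H))"
  have "bij_betw \<delta> {0..<nv (sprod G H)} (V \<times> W)"
    unfolding \<delta>_def nv_simps
    by (rule bij_betw_trans[OF bij_betw_div_mod bij_betw_map_prod[OF \<beta>(1) \<beta>'(1)]])
  moreover have "simeq (sprod G H) i j \<longleftrightarrow> rel_prod R S (\<delta> i) (\<delta> j)"
    if "i < nv (sprod G H)" "j < nv (sprod G H)" for i j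
  proof -
    have 0: "nv H > 0" using that by (auto intro: gr0I)
    have "i div nv H < nv G" "j div nv H < nv G" "i mod nv H < nv H" "j mod nv H < nv H"
      using that 0 by (auto simp: less_mult_imp_div_less)
    then have "rel_prod R S (\<delta> i) (\<delta> j) \<longleftrightarrow>
        simeq G (i div nv H) (j div nv H) \<and> simeq H (i mod nv H) (j mod nv H)"
      using \<beta>(2) \<beta>'(2) by (simp add: \<delta>_def)
    then show ?thesis using that by (auto simp: simeq_def adj_simps)
  qed
  ultimately show ?thesis
    using wf_sprod[OF assms[THEN presents_wf]] unfolding presents_def by (intro conjI exI[of _ \<delta>]) auto
qed

text \<open>Evaluates f on graphs whose vertices are pairs or lists, with \<open>R\<close> again
  read as "equal or adjacent".\<close>

definition gval :: "(graph \<Rightarrow> real) \<Rightarrow> 'a set \<Rightarrow> ('a \<Rightarrow> 'a \<Rightarrow> bool) \<Rightarrow> real" where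
  "gval f V R = f (canon V (\<lambda>x y. x \<noteq> y \<and> R x y))"

lemma gval_eq:
  assumes "DeltaG f" "finite V" "reflp R" "symp R" "presents G V R"
  shows "gval f V R = f G"
  unfolding gval_def by (rule presents_eq[OF assms(1) presents_canon[OF assms(2-4)] assms(5)])

lemma gval_nonneg:
  assumes "DeltaG f" "finite V" "reflp R" "symp R"
  shows "0 \<le> gval f V R"
  unfolding gval_def by (rule DeltaG_nonneg[OF assms(1) presents_wf[OF presents_canon[OF assms(2-4)]]])

lemma gval_mono:
  assumes "DeltaG f" "finite V" "reflp R" "symp R" "finite W" "reflp R'" "symp R'"
    and "\<phi> ` V \<subseteq> W" "\<And>x y. x \<in> V \<Longrightarrow> y \<in> V \<Longrightarrow> R' (\<phi> x) (\<phi> y) \<Longrightarrow> R x y"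
  shows "gval f V R \<le> gval f W R'"
  unfolding gval_def
  by (rule presents_mono[OF assms(1) presents_canon[OF assms(2-4)] presents_canon[OF assms(5-7)] assms(8,9)])

lemma gval_subset:
  assumes "DeltaG f" "reflp R" "symp R" "finite W" "V \<subseteq> W"
  shows "gval f V R \<le> gval f W R"
  using assms finite_subset[OF assms(5,4)] by (intro gval_mono[where \<phi> = id]) auto

lemma gval_cong_rel:
  assumes "DeltaG f" "finite V" "reflp R" "symp R" "reflp R'" "symp R'"
    and "\<And>x y. x \<in> V \<Longrightarrow> y \<in> V \<Longrightarrow> R x y \<longleftrightarrow> R' x y"
  shows "gval f V R = gval f V R'"
  by (intro antisym gval_mono[where \<phi> = id]) (use assms in auto)

lemma gval_empty: "DeltaG f \<Longrightarrow> reflp R \<Longrightarrow> symp R \<Longrightarrow> gval f {} R = 0"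
  by (simp add: gval_eq[OF _ _ _ _ presents_empty] DeltaG_empty)

lemma gval_ge_1:
  assumes "DeltaG f" "finite V" "reflp R" "symp R" "V \<noteq> {}"
  shows "1 \<le> gval f V R"
proof -
  obtain x where "x \<in> V" using assms by blast
  have "1 = gval f {x} R"
    by (simp add: gval_eq[OF assms(1) _ assms(3,4) presents_K1[OF assms(3)]] DeltaG_K1[OF assms(1)])
  also have "\<dots> \<le> gval f V R"
    using assms \<open>x \<in> V\<close> by (intro gval_subset) auto
  finally show ?thesis .
qed

lemma gval_disjoint_Un:
  assumes "DeltaG f" "reflp R" "symp R" "finite V" "finite W" "V \<inter> W = {}"
    and "\<And>x y. x \<in> V \<Longrightarrow> y \<in> W \<Longrightarrow> \<not> R x y"
  shows "gval f (V \<union> W) R = gval f V R + gval f W R"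
proof -
  let ?G = "canon V (\<lambda>x y. x \<noteq> y \<and> R x y)" and ?H = "canon W (\<lambda>x y. x \<noteq> y \<and> R x y)"
  have p: "presents ?G V R" "presents ?H W R"
    using assms by (auto intro: presents_canon)
  have "presents (dunion ?G ?H) (V \<union> W) R"
    using assms(6,7) sympD[OF assms(3)] by (intro presents_dunion p) metis+
  then have "gval f (V \<union> W) R = f (dunion ?G ?H)"
    using assms by (intro gval_eq) auto
  then show ?thesis
    using DeltaG_dunion[OF assms(1) p[THEN presents_wf]] by (simp add: gval_def)
qed

lemma gval_Times:
  assumes "DeltaG f" "reflp R" "symp R" "finite V" "reflp S" "symp S" "finite W"
  shows "gval f (V \<times> W) (rel_prod R S) = gval f V R * gval f W S"
proof -
  let ?G = "canon V (\<lambda>x y. x \<noteq> y \<and> R x y)" and ?H = "canon W (\<lambda>x y. x \<noteq> y \<and> S x y)"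
  have p: "presents ?G V R" "presents ?H W S"
    using assms by (auto intro: presents_canon)
  have "gval f (V \<times> W) (rel_prod R S) = f (sprod ?G ?H)"
    using assms presents_sprod[OF p]
    by (intro gval_eq) (auto intro: prod.rel_reflp prod.rel_symp)
  then show ?thesis
    using DeltaG_sprod[OF assms(1) p[THEN presents_wf]] by (simp add: gval_def)
qed

text \<open>Related vertices share a key, so each fibre is a union of components and additivity
  under disjoint union gives equality.\<close>

lemma gval_fibres:
  assumes "DeltaG f" "reflp R" "symp R" "finite V" "finite K" "key ` V \<subseteq> K"
    and "\<And>x y. x \<in> V \<Longrightarrow> y \<in> V \<Longrightarrow> R x y \<Longrightarrow> key x = key y"
  shows "gval f V R = (\<Sum>c\<in>K. gval f {x\<in>V. key x = c} R)"
  using assms(5,4,6,7)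
proof (induction K arbitrary: V rule: finite_induct)
  case empty
  then show ?case using assms by (auto simp: gval_empty)
next
  case (insert k K)
  let ?A = "{x\<in>V. key x = k}" and ?B = "{x\<in>V. key x \<noteq> k}"
  have "gval f V R = gval f (?A \<union> ?B) R"
    by (rule arg_cong[where f = "\<lambda>X. gval f X R"]) auto
  also have "\<dots> = gval f ?A R + gval f ?B R"
    using insert.prems assms by (intro gval_disjoint_Un) auto
  also have "gval f ?B R = (\<Sum>c\<in>K. gval f {x\<in>?B. key x = c} R)"
    using insert.prems by (intro insert.IH) auto
  also have "\<dots> = (\<Sum>c\<in>K. gval f {x\<in>V. key x = c} R)"
    using insert.hyps by (intro sum.cong arg_cong[where f = "\<lambda>X. gval f X R"]) auto
  finally show ?case using insert.hyps by simp
qed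

text \<open>Deleting the edges between different fibres can only increase f: the identity map is
  then a homomorphism of complements into the sparser graph, whose fibres are disjoint
  summands.\<close>

lemma gval_le_fibres:
  assumes "DeltaG f" "reflp R" "symp R" "finite V" "finite K" "key ` V \<subseteq> K"
  shows "gval f V R \<le> (\<Sum>c\<in>K. gval f {x\<in>V. key x = c} R)"
proof -
  define R' where "R' x y \<longleftrightarrow> R x y \<and> key x = key y" for x y
  have R': "reflp R'" "symp R'"
    using assms(2,3) by (auto simp: R'_def reflp_def symp_def)
  have "gval f V R \<le> gval f V R'"
    using assms R' by (intro gval_mono[where \<phi> = id]) (auto simp: R'_def)
  also have "\<dots> = (\<Sum>c\<in>K. gval f {x\<in>V. key x = c} R')"
    using assms R' by (intro gval_fibres) (auto simp: R'_def)
  also have "\<dots> = (\<Sum>c\<in>K. gval f {x\<in>V. key x = c} R)"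
    using assms R' by (intro sum.cong gval_cong_rel) (auto simp: R'_def)
  finally show ?thesis .
qed

section \<open>Type classes\<close>

text \<open>Fekete's lemma for superadditive sequences. The limit is the supremum of the quotients,
  whence the bound for every single m; that bound later carries an asymptotic comparison back to one
  given type.\<close>

lemma fekete:
  fixes u :: "nat \<Rightarrow> real"
  assumes "\<And>m n. u m + u n \<le> u (m + n)" "\<And>m. 0 \<le> u m" "\<And>m. u m \<le> real m * C"
  obtains l where "(\<lambda>m. u m / real m) \<longlonglongrightarrow> l" "\<And>m. u m \<le> real m * l" "0 \<le> l"
proof -
  define l where "l = (SUP m\<in>{1..}. u m / real m)"
  have bdd: "bdd_above ((\<lambda>m. u m / real m) ` {1..})"
    using assms(3) by (intro bdd_aboveI[of _ C]) (auto simp: divide_simps mult.commute)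
  have le: "u m / real m \<le> l" if "m \<ge> 1" for m
    unfolding l_def using bdd that by (intro cSUP_upper) auto
  have u0: "u 0 = 0"
    using assms(2,3)[of 0] by simp
  have mult: "real q * u m \<le> u (q * m)" for q m
  proof (induction q)
    case (Suc q)
    then show ?case using assms(1)[of "q * m" m] by (simp add: algebra_simps)
  qed (simp add: u0)
  have "(\<lambda>m. u m / real m) \<longlonglongrightarrow> l"
  proof (rule LIMSEQ_I)
    fix r :: real assume "0 < r"
    then have "l - r / 2 < (SUP m\<in>{1..}. u m / real m)" by (simp add: l_def)
    then obtain m where m: "m \<ge> 1" "l - r / 2 < u m / real m"
      using less_cSUP_iff[OF _ bdd] by auto
    \<comment> \<open>Beyond this threshold the term \<open>u m\<close>, lost to the remainder of n
      modulo m, is less than n * r / 2; the other half of r is spent on the choice of m.\<close>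
    obtain n1 :: nat where "2 * u m / r < real n1" using reals_Archimedean2 by blast
    then have n0: "2 * u m / r < real (Suc n1)" by simp
    have "norm (u n / real n - l) < r" if "Suc n1 \<le> n" for n
    proof -
      have n: "n \<ge> 1" using that by simp
      have "real n = real (n div m) * real m + real (n mod m)"
        by (metis div_mult_mod_eq of_nat_add of_nat_mult)
      moreover have "real (n mod m) \<le> real m" using m(1) by (simp add: less_imp_le)
      ultimately have "real n - real m \<le> real (n div m) * real m" by linarith
      then have "(real n - real m) * (u m / real m) \<le> real (n div m) * real m * (u m / real m)"
        using assms(2)[of m] by (intro mult_right_mono) auto
      also have "\<dots> = real (n div m) * u m" using m(1) by simp
      also have "\<dots> \<le> u (n div m * m) + u (n mod m)"
        using mult[of "n div m" m] assms(2)[of "n mod m"] by simp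
      also have "\<dots> \<le> u n"
        using assms(1)[of "n div m * m" "n mod m"] by simp
      finally have 1: "real n * (u m / real m) - u m \<le> u n"
        using m(1) by (simp add: left_diff_distrib diff_divide_distrib)
      have "2 * u m / r < real n" using n0 that by (simp add: less_le_trans)
      then have "u m < real n * (r / 2)" using \<open>0 < r\<close> by (simp add: field_simps)
      moreover have "real n * (l - r / 2) < real n * (u m / real m)"
        using m(2) n by (intro mult_strict_left_mono) auto
      ultimately have "real n * (l - r) < u n" using 1 by (simp add: algebra_simps)
      then have "l - r < u n / real n" using n by (simp add: field_simps)
      then show ?thesis using le[OF n] \<open>0 < r\<close> by simp
    qed
    then show "\<exists>n0. \<forall>n\<ge>n0. norm (u n / real n - l) < r" by blast
  qed
  moreover have "u m \<le> real m * l" for m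
    using le[of m] u0 by (cases "m = 0") (auto simp: field_simps)
  moreover have "0 \<le> l"
    using le[of 1] assms(2)[of 1] by simp
  ultimately show thesis using that by blast
qed

text \<open>Indexed by integer counts instead of distributions: the length is then the implicit
  \<open>sum a V\<close>, types add under concatenation, and no divisibility condition
  arises.\<close>

definition tclass :: "'a set \<Rightarrow> ('a \<Rightarrow> nat) \<Rightarrow> 'a list set" where
  "tclass V a = {xs. set xs \<subseteq> V \<and> (\<forall>v\<in>V. count_list xs v = a v)}"

definition tval :: "(graph \<Rightarrow> real) \<Rightarrow> 'a set \<Rightarrow> ('a \<Rightarrow> 'a \<Rightarrow> bool) \<Rightarrow> ('a \<Rightarrow> nat) \<Rightarrow> real" where
  "tval f V R a = gval f (tclass V a) (list_all2 R)"

lemma length_tclass: "finite V \<Longrightarrow> xs \<in> tclass V a \<Longrightarrow> length xs = sum a V"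
  using sum_count_set[of xs V] by (auto simp: tclass_def)

lemma finite_tclass: "finite V \<Longrightarrow> finite (tclass V a)"
  using length_tclass by (intro finite_subset[OF _ finite_lists_length_eq[of V "sum a V"]])
    (auto simp: tclass_def)

lemma tclass_nonempty:
  assumes "finite V"
  shows "tclass V a \<noteq> {}"
proof -
  obtain xs where xs: "mset xs = (\<Sum>v\<in>V. replicate_mset (a v) v)"
    using ex_mset by blast
  have "count_list xs w = (\<Sum>v\<in>V. if v = w then a v else 0)" for w
    unfolding count_mset[symmetric] xs by (auto simp: count_sum intro!: sum.cong)
  then have c: "count_list xs w = (if w \<in> V then a w else 0)" for w
    using assms by simp
  then have "set xs \<subseteq> V"
    by (metis count_list_0_iff subsetI)
  then have "xs \<in> tclass V a" using c by (simp add: tclass_def)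
  then show ?thesis by blast
qed

lemma prod_list_tclass:
  fixes g :: "'a \<Rightarrow> 'b::comm_monoid_mult"
  assumes "finite V" "xs \<in> tclass V a"
  shows "prod_list (map g xs) = (\<Prod>v\<in>V. g v ^ a v)"
proof -
  have "prod_list (map g xs) = (\<Prod>v\<in>V. g v ^ count_list xs v)" if "set xs \<subseteq> V"
    using that
  proof (induction xs)
    case (Cons x xs)
    have "(\<Prod>v\<in>V. g v ^ count_list (x # xs) v)
        = (\<Prod>v\<in>V. (if v = x then g v else 1) * g v ^ count_list xs v)"
      by (intro prod.cong) auto
    also have "\<dots> = g x * (\<Prod>v\<in>V. g v ^ count_list xs v)"
      using Cons.prems assms(1) by (simp add: prod.distrib)
    finally show ?case using Cons by simp
  qed simp
  then show ?thesis using assms(2) by (auto simp: tclass_def)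
qed

context
  fixes f :: "graph \<Rightarrow> real" and V :: "'a set" and R :: "'a \<Rightarrow> 'a \<Rightarrow> bool"
  assumes f: "DeltaG f" and V: "finite V" and R: "reflp R" "symp R"
begin

lemma tval_ge_1: "1 \<le> tval f V R a"
  unfolding tval_def using f V R
  by (intro gval_ge_1 finite_tclass tclass_nonempty list.rel_reflp list.rel_symp)

lemma tval_pos: "0 < tval f V R a"
  using tval_ge_1[of a] by linarith

text \<open>Concatenation maps the strong product of two type classes into the class of the summed
  type. All lists of the first class have equal length, so a relation between concatenations splits
  at the same place in both.\<close>

lemma tval_supermult: "tval f V R a * tval f V R b \<le> tval f V R (\<lambda>v. a v + b v)"
proof -
  have L: "reflp (list_all2 R)" "symp (list_all2 R)"
    using R by (auto intro: list.rel_reflp list.rel_symp)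
  have "tval f V R a * tval f V R b
      = gval f (tclass V a \<times> tclass V b) (rel_prod (list_all2 R) (list_all2 R))"
    unfolding tval_def using f V L by (intro gval_Times[symmetric] finite_tclass)
  also have "\<dots> \<le> tval f V R (\<lambda>v. a v + b v)"
    unfolding tval_def
  proof (rule gval_mono[where \<phi> = "\<lambda>(xs, ys). xs @ ys"])
    show "(\<lambda>(xs, ys). xs @ ys) ` (tclass V a \<times> tclass V b) \<subseteq> tclass V (\<lambda>v. a v + b v)"
      by (auto simp: tclass_def)
    fix p q assume "p \<in> tclass V a \<times> tclass V b" "q \<in> tclass V a \<times> tclass V b"
      and "list_all2 R (case p of (xs, ys) \<Rightarrow> xs @ ys) (case q of (xs, ys) \<Rightarrow> xs @ ys)"
    then show "rel_prod (list_all2 R) (list_all2 R) p q"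
      using length_tclass[OF V, of _ a] by (auto simp: list_all2_append)
  qed (use f V L in \<open>auto intro: finite_tclass prod.rel_reflp prod.rel_symp\<close>)
  finally show ?thesis .
qed

text \<open>A type is padded by the difference \<open>b - a\<close>, whose type class has value at
  least 1. This monotonicity takes the place of a continuity argument in the distribution.\<close>

lemma tval_mono:
  assumes "\<And>v. v \<in> V \<Longrightarrow> a v \<le> b v"
  shows "tval f V R a \<le> tval f V R b"
proof -
  have "tval f V R a \<le> tval f V R a * tval f V R (\<lambda>v. b v - a v)"
    using tval_ge_1[of a] tval_ge_1[of "\<lambda>v. b v - a v"] by simp
  also have "\<dots> \<le> tval f V R (\<lambda>v. a v + (b v - a v))" by (rule tval_supermult)
  also have "\<dots> = tval f V R b"
    using assms unfolding tval_def tclass_def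
    by (intro arg_cong[where f = "\<lambda>X. gval f X _"]) auto
  finally show ?thesis .
qed

end

section \<open>Powers of weighted coloured graphs\<close>

lemma power_sum_lists:
  fixes t :: "'a \<Rightarrow> 'b::comm_semiring_1"
  assumes "finite C"
  shows "(\<Sum>c\<in>C. t c) ^ n = (\<Sum>cs | set cs \<subseteq> C \<and> length cs = n. prod_list (map t cs))"
proof (induction n)
  case 0
  have "{cs. set cs \<subseteq> C \<and> length cs = 0} = {[]}" by auto
  then show ?case by simp
next
  case (Suc n)
  let ?L = "{cs. set cs \<subseteq> C \<and> length cs = n}"
  have "{cs. set cs \<subseteq> C \<and> length cs = Suc n} = (\<lambda>p. fst p # snd p) ` (C \<times> ?L)"
    by (auto simp: length_Suc_conv image_iff)
  moreover have "inj_on (\<lambda>p. fst p # snd p) (C \<times> ?L)"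
    by (auto simp: inj_on_def)
  ultimately have "(\<Sum>cs | set cs \<subseteq> C \<and> length cs = Suc n. prod_list (map t cs))
      = (\<Sum>p\<in>C \<times> ?L. t (fst p) * prod_list (map t (snd p)))"
    by (simp add: sum.reindex)
  also have "\<dots> = (\<Sum>c\<in>C. t c) * (\<Sum>cs\<in>?L. prod_list (map t cs))"
    by (simp add: sum_product sum.cartesian_product case_prod_beta)
  finally show ?case using Suc by simp
qed

text \<open>With \<open>clr = fst\<close> and weights d^\<alpha> this is f_\<alpha> of the coloured
  graph; with a constant colour and weight 1 it is f of the whole graph, which bounds the growth of
  type classes.\<close>

definition wval :: "(graph \<Rightarrow> real) \<Rightarrow> 'a set \<Rightarrow> ('a \<Rightarrow> 'a \<Rightarrow> bool) \<Rightarrow> ('a \<Rightarrow> 'c) \<Rightarrow> ('c \<Rightarrow> real) \<Rightarrow> real"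
  where "wval f V R clr \<omega> = (\<Sum>c\<in>clr ` V. gval f {x\<in>V. clr x = c} R * \<omega> c)"

context
  fixes f :: "graph \<Rightarrow> real" and V :: "'a set" and R :: "'a \<Rightarrow> 'a \<Rightarrow> bool"
    and clr :: "'a \<Rightarrow> 'c" and \<omega> :: "'c \<Rightarrow> real"
  assumes f: "DeltaG f" and V: "finite V" and R: "reflp R" "symp R"
    and clr: "\<And>x y. R x y \<Longrightarrow> clr x = clr y" and \<omega>: "\<And>c. 0 \<le> \<omega> c"
begin

lemma list_rel_refl_symp: "reflp (list_all2 R)" "symp (list_all2 R)"
  using R by (auto intro: list.rel_reflp list.rel_symp)

lemma finite_colour_class: "finite {xs. set xs \<subseteq> V \<and> map clr xs = cs}"
  by (rule finite_subset[OF _ finite_lists_length_eq[OF V, of "length cs"]]) auto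

text \<open>The lists with a prescribed colour sequence form the strong product of the corresponding
  colour classes, one coordinate at a time.\<close>

lemma gval_colour_class:
  "gval f {xs. set xs \<subseteq> V \<and> map clr xs = cs} (list_all2 R)
     = prod_list (map (\<lambda>c. gval f {x\<in>V. clr x = c} R) cs)"
proof (induction cs)
  case Nil
  have "{xs. set xs \<subseteq> V \<and> map clr xs = []} = {[]}" by auto
  moreover have "gval f {[]} (list_all2 R) = 1"
    using gval_eq[OF f _ list_rel_refl_symp presents_K1[OF list_rel_refl_symp(1)]] DeltaG_K1[OF f]
    by simp
  ultimately show ?case by simp
next
  case (Cons c cs)
  let ?A = "{x\<in>V. clr x = c}" and ?B = "{xs. set xs \<subseteq> V \<and> map clr xs = cs}"
  let ?L = "{xs. set xs \<subseteq> V \<and> map clr xs = c # cs}"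
  have fin: "finite ?A" "finite ?B" "finite ?L"
    using V finite_colour_class by auto
  have rel: "reflp (rel_prod R (list_all2 R))" "symp (rel_prod R (list_all2 R))"
    using R list_rel_refl_symp by (auto intro: prod.rel_reflp prod.rel_symp)
  have "gval f ?L (list_all2 R) = gval f (?A \<times> ?B) (rel_prod R (list_all2 R))"
  proof (rule antisym)
    show "gval f ?L (list_all2 R) \<le> gval f (?A \<times> ?B) (rel_prod R (list_all2 R))"
      using f fin rel list_rel_refl_symp
      by (intro gval_mono[where \<phi> = "\<lambda>xs. (hd xs, tl xs)"]) (auto simp: map_eq_Cons_conv)
    show "gval f (?A \<times> ?B) (rel_prod R (list_all2 R)) \<le> gval f ?L (list_all2 R)"
      using f fin rel list_rel_refl_symp
      by (intro gval_mono[where \<phi> = "\<lambda>p. fst p # snd p"]) auto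
  qed
  also have "\<dots> = gval f ?A R * gval f ?B (list_all2 R)"
    using f R fin list_rel_refl_symp by (intro gval_Times)
  finally show ?case using Cons by simp
qed

lemma wval_power:
  "wval f V R clr \<omega> ^ n = (\<Sum>cs | set cs \<subseteq> clr ` V \<and> length cs = n.
     gval f {xs. set xs \<subseteq> V \<and> map clr xs = cs} (list_all2 R) * prod_list (map \<omega> cs))"
proof -
  have "prod_list (map (\<lambda>c. gval f {x\<in>V. clr x = c} R * \<omega> c) cs)
      = gval f {xs. set xs \<subseteq> V \<and> map clr xs = cs} (list_all2 R) * prod_list (map \<omega> cs)" for cs
    unfolding gval_colour_class by (induction cs) auto
  then show ?thesis
    unfolding wval_def using V by (simp add: power_sum_lists)
qed

lemma list_rel_colour: "list_all2 R xs ys \<Longrightarrow> map clr xs = map clr ys"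
  by (induction rule: list_all2_induct) (auto dest: clr)

lemma prod_list_weight_nonneg: "0 \<le> prod_list (map \<omega> cs)"
  by (induction cs) (auto simp: \<omega>)

text \<open>Edges respect colours, so a type class is the disjoint union of its parts with fixed
  colour sequence. Each part lies in a product of colour classes, and its weight depends on the type
  alone.\<close>

lemma tval_le_wval_power:
  "tval f V R a * (\<Prod>v\<in>V. \<omega> (clr v) ^ a v) \<le> wval f V R clr \<omega> ^ sum a V"
proof -
  let ?K = "{cs. set cs \<subseteq> clr ` V \<and> length cs = sum a V}"
  let ?D = "\<Prod>v\<in>V. \<omega> (clr v) ^ a v"
  have "tval f V R a = (\<Sum>cs\<in>?K. gval f {xs\<in>tclass V a. map clr xs = cs} (list_all2 R))"
    unfolding tval_def
  proof (rule gval_fibres)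
    show "map clr ` tclass V a \<subseteq> ?K"
      using length_tclass[OF V, of _ a] by (auto simp: tclass_def subset_iff)
  qed (use f V list_rel_refl_symp list_rel_colour in \<open>auto intro: finite_tclass finite_lists_length_eq\<close>)
  then have "tval f V R a * ?D
      = (\<Sum>cs\<in>?K. gval f {xs\<in>tclass V a. map clr xs = cs} (list_all2 R) * ?D)"
    by (simp add: sum_distrib_right)
  also have "\<dots> \<le> (\<Sum>cs\<in>?K. gval f {xs. set xs \<subseteq> V \<and> map clr xs = cs} (list_all2 R)
      * prod_list (map \<omega> cs))"
  proof (rule sum_mono)
    fix cs
    let ?X = "{xs\<in>tclass V a. map clr xs = cs}"
    have "gval f ?X (list_all2 R) * ?D = gval f ?X (list_all2 R) * prod_list (map \<omega> cs)"
    \<comment> \<open>An empty part has value 0; otherwise some list has both this type and this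
      colour sequence, so the two expressions for the weight agree.\<close>
    proof (cases "?X = {}")
      case True
      show ?thesis unfolding True gval_empty[OF f list_rel_refl_symp] by simp
    next
      case False
      then obtain xs where "xs \<in> tclass V a" "map clr xs = cs" by blast
      then show ?thesis
        using prod_list_tclass[OF V, of xs a "\<lambda>x. \<omega> (clr x)"] by (auto simp: comp_def)
    qed
    also have "\<dots> \<le> gval f {xs. set xs \<subseteq> V \<and> map clr xs = cs} (list_all2 R) * prod_list (map \<omega> cs)"
      using f list_rel_refl_symp finite_colour_class prod_list_weight_nonneg
      by (intro mult_right_mono gval_subset) (auto simp: tclass_def)
    finally show "gval f ?X (list_all2 R) * ?D \<le> \<dots>" .
  qed
  finally show ?thesis by (simp add: wval_power)
qed

text \<open>Splitting each colour class by type can only increase the value, because edges between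
  different types are dropped. Regrouping by type then collects, for each type, pieces of its own
  type class.\<close>

lemma wval_power_le_tval:
  "wval f V R clr \<omega> ^ n \<le> (\<Sum>a | a \<in> PiE V (\<lambda>_. {0..n}) \<and> sum a V = n. tval f V R a * (\<Prod>v\<in>V. \<omega> (clr v) ^ a v))"
proof -
  let ?K = "{cs. set cs \<subseteq> clr ` V \<and> length cs = n}"
  let ?T = "{a. a \<in> PiE V (\<lambda>_. {0..n}) \<and> sum a V = n}"
  let ?L = "{xs. set xs \<subseteq> V \<and> length xs = n}"
  \<comment> \<open>Restriction makes the count functions extensional, so that the keys range over a
    finite \<open>PiE\<close>.\<close>
  define key where "key xs = restrict (count_list xs) V" for xs :: "'a list"
  define D where "D a = (\<Prod>v\<in>V. \<omega> (clr v) ^ a v)" for a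
  let ?X = "\<lambda>cs a. {xs\<in>{xs. set xs \<subseteq> V \<and> map clr xs = cs}. key xs = a}"
  have finT: "finite ?T" using V by (intro finite_subset[OF _ finite_PiE[of V "\<lambda>_. {0..n}"]]) auto
  have finK: "finite ?K" using V by (intro finite_lists_length_eq) auto
  have finL: "finite ?L" using V by (intro finite_lists_length_eq) auto
  have tclassI: "xs \<in> tclass V a" if "set xs \<subseteq> V" "key xs = a" for xs a
    using that by (auto simp: tclass_def key_def)
  have weight: "gval f (?X cs a) (list_all2 R) * prod_list (map \<omega> cs) = gval f (?X cs a) (list_all2 R) * D a" for cs a
  proof (cases "?X cs a = {}")
    case True
    show ?thesis unfolding True gval_empty[OF f list_rel_refl_symp] by simp
  next
    case False
    then obtain xs where "xs \<in> tclass V a" "map clr xs = cs" using tclassI by blast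
    then show ?thesis
      using prod_list_tclass[OF V, of xs a "\<lambda>x. \<omega> (clr x)"] by (auto simp: comp_def D_def)
  qed
  have "wval f V R clr \<omega> ^ n \<le> (\<Sum>cs\<in>?K. (\<Sum>a\<in>?T. gval f (?X cs a) (list_all2 R)) * prod_list (map \<omega> cs))"
    unfolding wval_power
  proof (intro sum_mono mult_right_mono prod_list_weight_nonneg gval_le_fibres f list_rel_refl_symp
      finite_colour_class finT)
    fix cs assume cs: "cs \<in> ?K"
    show "key ` {xs. set xs \<subseteq> V \<and> map clr xs = cs} \<subseteq> ?T"
    proof (rule image_subsetI)
      fix xs assume "xs \<in> {xs. set xs \<subseteq> V \<and> map clr xs = cs}"
      then have "set xs \<subseteq> V" "length xs = n" using cs by auto
      then show "key xs \<in> ?T"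
        using count_le_length[of xs] sum_count_set[OF _ V, of xs] by (auto simp: key_def)
    qed
  qed
  also have "\<dots> = (\<Sum>a\<in>?T. (\<Sum>cs\<in>?K. gval f (?X cs a) (list_all2 R)) * D a)"
    unfolding sum_distrib_right weight by (rule sum.swap)
  also have "\<dots> \<le> (\<Sum>a\<in>?T. tval f V R a * D a)"
  proof (intro sum_mono mult_right_mono)
    fix a
    have "(\<Sum>cs\<in>?K. gval f (?X cs a) (list_all2 R))
        = (\<Sum>cs\<in>?K. gval f {xs\<in>{xs\<in>?L. key xs = a}. map clr xs = cs} (list_all2 R))"
      by (intro sum.cong arg_cong[where f = "\<lambda>X. gval f X _"]) auto
    \<comment> \<open>Related lists have equal colours, so this time the splitting is an equality
      and the pieces add up without loss.\<close>
    also have "\<dots> = gval f {xs\<in>?L. key xs = a} (list_all2 R)"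
      using f finite_subset[OF _ finL, of "{xs\<in>?L. key xs = a}"] finK list_rel_refl_symp list_rel_colour
      by (intro gval_fibres[symmetric]) (auto simp: subset_iff)
    also have "\<dots> \<le> tval f V R a"
      unfolding tval_def using f V list_rel_refl_symp tclassI
      by (intro gval_subset finite_tclass) auto
    finally show "(\<Sum>cs\<in>?K. gval f (?X cs a) (list_all2 R)) \<le> tval f V R a" .
    show "0 \<le> D a" unfolding D_def using \<omega> by (intro prod_nonneg) auto
  qed
  finally show ?thesis by (simp add: D_def)
qed

end

section \<open>Growth rates and the probabilistic refinement\<close>

lemma tendsto_floor_div: "(\<lambda>n. of_int \<lfloor>real n * x\<rfloor> / real n) \<longlonglongrightarrow> x"
proof (rule tendsto_sandwich[where f = "\<lambda>n. x - 1 / real n" and h = "\<lambda>_. x"])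
  show "\<forall>\<^sub>F n in sequentially. x - 1 / real n \<le> of_int \<lfloor>real n * x\<rfloor> / real n"
    using eventually_gt_at_top[of 0]
  proof eventually_elim
    case (elim n)
    have "real n * x - 1 \<le> of_int \<lfloor>real n * x\<rfloor>" by linarith
    then have "(real n * x - 1) / real n \<le> of_int \<lfloor>real n * x\<rfloor> / real n"
      by (intro divide_right_mono) auto
    then show ?case using elim by (simp add: diff_divide_distrib)
  qed
  show "\<forall>\<^sub>F n in sequentially. of_int \<lfloor>real n * x\<rfloor> / real n \<le> x"
    using eventually_gt_at_top[of 0]
  proof eventually_elim
    case (elim n)
    have "of_int \<lfloor>real n * x\<rfloor> \<le> real n * x" by linarith
    then show ?case using elim by (simp add: field_simps)
  qed
  have "(\<lambda>n. x - 1 / real n) \<longlonglongrightarrow> x - 0"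
    by (intro tendsto_diff tendsto_const lim_1_over_n)
  then show "(\<lambda>n. x - 1 / real n) \<longlonglongrightarrow> x" by simp
qed simp

text \<open>\<open>type_seq\<close> is a choice, so its properties are available only once some
  sequence is exhibited. All masses are rounded down except at vertex 0, which receives the
  remainder and hence stays nonnegative.\<close>

lemma type_seq_exists:
  assumes "pdist k P" "k > 0"
  shows "\<exists>s. (\<forall>n\<ge>1. ntype k n (s n)) \<and> (\<forall>v<k. (\<lambda>n. s n v) \<longlonglongrightarrow> P v)"
proof -
  define q :: "nat \<Rightarrow> nat \<Rightarrow> int" where "q n v = \<lfloor>real n * P v\<rfloor>" for n v
  define s where "s n v = (if v = 0 then 1 - (\<Sum>w\<in>{1..<k}. of_int (q n w) / real n)
                           else of_int (q n v) / real n)" for n v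
  have k: "{..<k} = insert 0 {1..<k}" using assms(2) by auto
  have P: "P v \<ge> 0" if "v < k" for v using assms that by (simp add: pdist_def)
  have P1: "P 0 + (\<Sum>w\<in>{1..<k}. P w) = 1"
    using assms(1) unfolding pdist_def k by simp
  have "ntype k n (s n)" if n: "n \<ge> 1" for n
  proof -
    have q0: "q n v \<ge> 0" if "v < k" for v using P[OF that] by (simp add: q_def)
    have "(\<Sum>w\<in>{1..<k}. of_int (q n w) / real n) \<le> (\<Sum>w\<in>{1..<k}. P w)"
    proof (rule sum_mono)
      fix w
      have "of_int (q n w) \<le> real n * P w" unfolding q_def by linarith
      then show "of_int (q n w) / real n \<le> P w" using n by (simp add: field_simps)
    qed
    then have s0: "0 \<le> s n 0" using P1 P[of 0] assms(2) by (simp add: s_def)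
    have s: "0 \<le> s n v" if "v < k" for v
      using s0 q0[OF that] by (cases "v = 0") (auto simp: s_def)
    have "(\<Sum>v<k. s n v) = 1"
      unfolding k by (simp add: s_def)
    moreover have "\<exists>m::nat. real n * s n v = real m" if v: "v < k" for v
    proof -
      have "real n * s n v = of_int (if v = 0 then int n - (\<Sum>w\<in>{1..<k}. q n w) else q n v)"
        using n by (auto simp: s_def right_diff_distrib sum_distrib_left)
      moreover have "real n * s n v \<ge> 0" using s[OF v] by simp
      ultimately show ?thesis by (intro exI[of _ "nat (if v = 0 then int n - (\<Sum>w\<in>{1..<k}. q n w) else q n v)"]) (simp only: of_int_0_le_iff of_nat_nat)
    qed
    ultimately show ?thesis using s by (auto simp: ntype_def pdist_def)
  qed
  moreover have "(\<lambda>n. s n v) \<longlonglongrightarrow> P v" for v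
  proof (cases "v = 0")
    case True
    have "(\<lambda>n. s n v) \<longlonglongrightarrow> 1 - (\<Sum>w\<in>{1..<k}. P w)"
      unfolding s_def q_def using True by (auto intro!: tendsto_intros tendsto_floor_div)
    moreover have "1 - (\<Sum>w\<in>{1..<k}. P w) = P v" using P1 True by simp
    ultimately show ?thesis by simp
  next
    case False
    then show ?thesis unfolding s_def q_def by (auto intro!: tendsto_floor_div)
  qed
  ultimately show ?thesis by blast
qed

context
  fixes f :: "graph \<Rightarrow> real" and V :: "'a set" and R :: "'a \<Rightarrow> 'a \<Rightarrow> bool"
  assumes f: "DeltaG f" and V: "finite V" and R: "reflp R" "symp R"
begin

text \<open>Superadditivity of the logarithms comes from concatenation, and the linear upper bound
  from placing the type class inside the full strong power.\<close>

lemma tval_growth_rate: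
  obtains l where "(\<lambda>m. ln (tval f V R (\<lambda>v. m * a v)) / real m) \<longlonglongrightarrow> l"
    "\<And>m. ln (tval f V R (\<lambda>v. m * a v)) \<le> real m * l" "0 \<le> l"
proof -
  note ge1 = tval_ge_1[OF f V R]
  define u where "u m = ln (tval f V R (\<lambda>v. m * a v))" for m :: nat
  have "u m + u n \<le> u (m + n)" for m n
  proof -
    have "tval f V R (\<lambda>v. m * a v) * tval f V R (\<lambda>v. n * a v) \<le> tval f V R (\<lambda>v. (m + n) * a v)"
      using tval_supermult[OF f V R, of "\<lambda>v. m * a v" "\<lambda>v. n * a v"] by (simp add: algebra_simps)
    then have "ln (tval f V R (\<lambda>v. m * a v) * tval f V R (\<lambda>v. n * a v)) \<le> u (m + n)"
      unfolding u_def using tval_pos[OF f V R] by (intro ln_mono) auto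
    then show ?thesis
      using ge1[of "\<lambda>v. m * a v"] ge1[of "\<lambda>v. n * a v"] by (simp add: ln_mult u_def)
  qed
  moreover have "0 \<le> u m" for m unfolding u_def using ge1 by simp
  moreover have "u m \<le> real m * (real (sum a V) * ln (wval f V R (\<lambda>_. ()) (\<lambda>_. 1)))" for m
  proof -
    have le: "tval f V R (\<lambda>v. m * a v) \<le> wval f V R (\<lambda>_. ()) (\<lambda>_. 1) ^ (m * sum a V)"
      using tval_le_wval_power[OF f V R, of "\<lambda>_. ()" "\<lambda>_. 1" "\<lambda>v. m * a v"]
      by (simp add: sum_distrib_left)
    have "0 \<le> wval f V R (\<lambda>_. ()) (\<lambda>_. 1)"
      unfolding wval_def using gval_nonneg[OF f _ R] V by (intro sum_nonneg) auto
    moreover have "1 \<le> wval f V R (\<lambda>_. ()) (\<lambda>_. 1) ^ (m * sum a V)" by (rule order_trans[OF ge1 le])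
    ultimately have "u m \<le> ln (wval f V R (\<lambda>_. ()) (\<lambda>_. 1) ^ (m * sum a V))"
      unfolding u_def using le ge1[of "\<lambda>v. m * a v"] by (intro ln_mono) auto
    then show ?thesis by (simp add: ln_realpow mult.assoc)
  qed
  ultimately show thesis
    by (rule fekete[of u]) (rule that, simp_all add: u_def)
qed

text \<open>Multiples of \<open>a\<close> sandwich any sequence of types converging to the direction of \<open>a\<close>,
  since \<open>a\<close> has full support and \<open>tval\<close> is monotone.\<close>
lemma tval_limit_along_types:
  assumes a: "\<And>v. v \<in> V \<Longrightarrow> 0 < a v" and N: "sum a V = N" "0 < N"
    and l: "(\<lambda>m. ln (tval f V R (\<lambda>v. m * a v)) / real m) \<longlonglongrightarrow> l"
    and u: "\<And>m. ln (tval f V R (\<lambda>v. m * a v)) \<le> real m * l" and l0: "0 \<le> l"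
    and c: "\<And>v. v \<in> V \<Longrightarrow> (\<lambda>n. real (c n v) / real n) \<longlonglongrightarrow> real (a v) / real N"
  shows "(\<lambda>n. ln (tval f V R (c n)) / real n) \<longlonglongrightarrow> l / real N"
proof (rule LIMSEQ_I)
  fix r :: real assume r: "0 < r"
  note ge1 = tval_ge_1[OF f V R]
  define L where "L = l / real N"
  \<comment> \<open>The final error is e * L + 2 * e: the first term from scaling the type by 1 - e
    or 1 + e, one e from the lower estimate \<open>l - e\<close> of the rate, one from rounding,
    which costs \<open>l / real n\<close>. The cap 1/2 keeps 1 - e positive.\<close>
  define e where "e = min (1 / 2) (r / (L + 3))"
  have L0: "0 \<le> L" using l0 by (simp add: L_def)
  have e: "0 < e" "e < 1" "e * (L + 3) \<le> r"
  proof -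
    have "e * (L + 3) \<le> r / (L + 3) * (L + 3)"
      using L0 by (intro mult_right_mono) (auto simp: e_def)
    then show "e * (L + 3) \<le> r" using L0 by simp
  qed (use r L0 in \<open>auto simp: e_def\<close>)
   have "\<forall>\<^sub>F q in sequentially. l - e < ln (tval f V R (\<lambda>v. q * a v)) / real q"
    using e by (intro order_tendstoD(1)[OF l]) auto
  then obtain q0 where q0: "\<And>q. q \<ge> q0 \<Longrightarrow> l - e < ln (tval f V R (\<lambda>v. q * a v)) / real q"
    by (auto simp: eventually_sequentially)
  have "\<forall>\<^sub>F n in sequentially. \<forall>v\<in>V. (1 - e) * (real (a v) / real N) < real (c n v) / real n"
  proof (intro eventually_ball_finite V ballI order_tendstoD(1)[OF c])
    fix v assume "v \<in> V"
    then have "0 < real (a v) / real N" using a N(2) by simp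
    from mult_strict_right_mono[OF _ this, of "1 - e" 1]
    show "(1 - e) * (real (a v) / real N) < real (a v) / real N" using e by simp
  qed
  moreover have "\<forall>\<^sub>F n in sequentially. \<forall>v\<in>V. real (c n v) / real n < (1 + e) * (real (a v) / real N)"
  proof (intro eventually_ball_finite V ballI order_tendstoD(2)[OF c])
    fix v assume "v \<in> V"
    then have "0 < real (a v) / real N" using a N(2) by simp
    from mult_strict_right_mono[OF _ this, of 1 "1 + e"]
    show "real (a v) / real N < (1 + e) * (real (a v) / real N)" using e by simp
  qed
  moreover have "\<forall>\<^sub>F n in sequentially. l / real n < e"
    using e by (intro order_tendstoD(2)[OF lim_const_over_n])
  \<comment> \<open>This makes (1 - e) * n / N at least q0 + 2, so that the floor \<open>q\<close>
    below is at least q0 + 1: the rate estimate applies to it and division by it is allowed.\<close>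
  moreover have "\<forall>\<^sub>F n in sequentially. n \<ge> nat \<lceil>(real q0 + 2) * real N / (1 - e)\<rceil> + 1"
    by (rule eventually_ge_at_top)
  ultimately have "\<forall>\<^sub>F n in sequentially. norm (ln (tval f V R (c n)) / real n - l / real N) < r"
  proof eventually_elim
    case (elim n)
    define x where "x = ln (tval f V R (c n)) / real n"
    have n: "n > 0" "(real q0 + 2) * real N / (1 - e) \<le> real n" using elim(4) by linarith+
    \<comment> \<open>The integers \<open>q\<close> and \<open>p\<close> give the squeeze q * a
      \<le> c n \<le> p * a, because each count of \<open>c n\<close> lies between (1 - e) and (1 +
      e) times n * a / N.\<close>
    define q where "q = nat \<lfloor>(1 - e) * real n / real N\<rfloor>"
    define p where "p = nat \<lceil>(1 + e) * real n / real N\<rceil>"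
    have q: "real q \<le> (1 - e) * real n / real N" "(1 - e) * real n / real N - 1 \<le> real q"
      using e n N unfolding q_def by (simp_all add: floor_correct of_nat_nat)
    have p: "(1 + e) * real n / real N \<le> real p" "real p \<le> (1 + e) * real n / real N + 1"
      using e n N unfolding p_def by (simp_all add: le_of_int_ceiling of_nat_nat)
    have "real q0 + 2 \<le> (1 - e) * real n / real N"
      using n(2) e N by (simp add: field_simps)
    then have qq: "q \<ge> q0" "q > 0" using q(2) by linarith+
    have "(1 - e) * real n / real N \<le> real n / 1"
      using e N by (intro frac_le) (auto simp: mult_left_le_one_le)
    then have qn: "real q \<le> real n" using q(1) by simp
    have "tval f V R (\<lambda>v. q * a v) \<le> tval f V R (c n)"
    proof (rule tval_mono[OF f V R])
      fix v assume v: "v \<in> V"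
      have "real (q * a v) \<le> (1 - e) * real n / real N * real (a v)"
        using mult_right_mono[OF q(1), of "real (a v)"] by simp
      also have "\<dots> \<le> real (c n v)"
        using elim(1) v n by (auto simp: field_simps dest!: bspec[of _ _ v])
      finally show "q * a v \<le> c n v" by (simp only: of_nat_le_iff)
    qed
    then have "ln (tval f V R (\<lambda>v. q * a v)) \<le> ln (tval f V R (c n))"
      using tval_pos[OF f V R] by (intro ln_mono) auto
    moreover have "real q * (l - e) \<le> ln (tval f V R (\<lambda>v. q * a v))"
      using q0[OF qq(1)] qq(2) by (simp add: field_simps)
    moreover have "real q * (l - e) \<ge> ((1 - e) * real n / real N - 1) * l - real n * e"
      using mult_right_mono[OF q(2) l0] mult_right_mono[OF qn, of e] e
      by (simp only: right_diff_distrib) linarith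
    ultimately have "((1 - e) * real n / real N - 1) * l - real n * e \<le> ln (tval f V R (c n))"
      by linarith
    then have "(((1 - e) * real n / real N - 1) * l - real n * e) / real n \<le> x"
      unfolding x_def using n by (intro divide_right_mono) auto
    also have "(((1 - e) * real n / real N - 1) * l - real n * e) / real n
        = (1 - e) * L - l / real n - e"
      using n N by (simp add: L_def field_simps)
    finally have lower: "(1 - e) * L - l / real n - e \<le> x" .
    have "tval f V R (c n) \<le> tval f V R (\<lambda>v. p * a v)"
    proof (rule tval_mono[OF f V R])
      fix v assume v: "v \<in> V"
      have "real (c n v) \<le> (1 + e) * real n / real N * real (a v)"
        using elim(2) v n by (auto simp: field_simps dest!: bspec[of _ _ v])
      also have "\<dots> \<le> real (p * a v)"
        using mult_right_mono[OF p(1), of "real (a v)"] by simp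
      finally show "c n v \<le> p * a v" by (simp only: of_nat_le_iff)
    qed
    then have "ln (tval f V R (c n)) \<le> ln (tval f V R (\<lambda>v. p * a v))"
      using tval_pos[OF f V R] by (intro ln_mono) auto
    also have "\<dots> \<le> real p * l" by (rule u)
    also have "\<dots> \<le> ((1 + e) * real n / real N + 1) * l"
      using p(2) l0 by (rule mult_right_mono)
    finally have "x \<le> ((1 + e) * real n / real N + 1) * l / real n"
      unfolding x_def using n by (intro divide_right_mono) auto
    also have "\<dots> = (1 + e) * L + l / real n"
      using n N by (simp add: L_def field_simps)
    finally have "x \<le> (1 + e) * L + l / real n" .
    with lower have "\<bar>x - L\<bar> < e * L + e + e"
      using elim(3) e by (auto simp: abs_if algebra_simps)
    also have "\<dots> \<le> r" using e by (simp add: algebra_simps)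
    finally show ?case by (simp add: x_def L_def)
  qed
  then show "\<exists>n0. \<forall>n\<ge>n0. norm (ln (tval f V R (c n)) / real n - l / real N) < r"
    by (simp add: eventually_sequentially)
qed

end

lemma type_graph_tval:
  assumes f: "DeltaG f" and G: "wf_graph G" and c: "\<And>v. v < nv G \<Longrightarrow> real n * Q v = real (c v)"
    and n: "(\<Sum>v<nv G. c v) = n"
  shows "f (type_graph G n Q) = tval f {0..<nv G} (simeq G) c"
proof -
  let ?R = "\<lambda>xs ys. \<forall>k<n. simeq G (xs ! k) (ys ! k)"
  have len: "length xs = n" if "xs \<in> tclass {0..<nv G} c" for xs
    using length_tclass[OF _ that] n by (simp add: atLeast0LessThan)
  have eq: "{xs. length xs = n \<and> set xs \<subseteq> {0..<nv G} \<and>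
          (\<forall>v<nv G. real (count_list xs v) = real n * Q v)} = tclass {0..<nv G} c"
  proof (intro equalityI subsetI)
    fix xs assume "xs \<in> tclass {0..<nv G} c"
    then show "xs \<in> {xs. length xs = n \<and> set xs \<subseteq> {0..<nv G} \<and>
          (\<forall>v<nv G. real (count_list xs v) = real n * Q v)}"
      using c len[of xs] by (simp add: tclass_def)
  qed (use c in \<open>simp add: tclass_def\<close>)
  have "f (type_graph G n Q) = gval f (tclass {0..<nv G} c) ?R"
    unfolding type_graph_def eq gval_def by simp
  \<comment> \<open>The indexwise relation ignores lengths, unlike \<open>list_all2\<close>; they
    coincide on the type class, all of whose lists have length n.\<close>
  also have "\<dots> = gval f (tclass {0..<nv G} c) (list_all2 (simeq G))"
  proof (rule gval_cong_rel[OF f])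
    show "reflp ?R" "symp ?R"
      using reflp_simeq[of G] symp_simeq[OF G] by (auto simp: reflp_def symp_def)
  qed (auto simp: len list_all2_conv_all_nth finite_tclass
        intro!: list.rel_reflp list.rel_symp reflp_simeq symp_simeq G)
  finally show ?thesis by (simp add: tval_def)
qed

text \<open>The rate along the multiples of \<open>a\<close> carries over to the unspecified
  \<open>type_seq\<close> by the squeeze. The type m * a has length m * N, which accounts for the
  division by N.\<close>

lemma ln_prob_ref:
  assumes f: "DeltaG f" and G: "wf_graph G" and a: "\<And>v. v < nv G \<Longrightarrow> 0 < a v"
    and N: "(\<Sum>v<nv G. a v) = N" "0 < N"
    and l: "(\<lambda>m. ln (tval f {0..<nv G} (simeq G) (\<lambda>v. m * a v)) / real m) \<longlonglongrightarrow> l"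
    and u: "\<And>m. ln (tval f {0..<nv G} (simeq G) (\<lambda>v. m * a v)) \<le> real m * l" and l0: "0 \<le> l"
  shows "ln (prob_ref f G (\<lambda>v. real (a v) / real N)) = l / real N"
proof -
  let ?P = "\<lambda>v. real (a v) / real N"
  have k: "nv G > 0" using N by (auto intro: gr0I)
  have "pdist (nv G) ?P"
    using N by (simp add: pdist_def flip: sum_divide_distrib of_nat_sum)
  from type_seq_exists[OF this k]
  have "(\<forall>n\<ge>1. ntype (nv G) n (type_seq G ?P n)) \<and>
        (\<forall>v<nv G. (\<lambda>n. type_seq G ?P n v) \<longlonglongrightarrow> ?P v)"
    unfolding type_seq_def by (rule someI_ex)
  then have nt: "\<And>n. n \<ge> 1 \<Longrightarrow> ntype (nv G) n (type_seq G ?P n)"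
    and lim: "\<And>v. v < nv G \<Longrightarrow> (\<lambda>n. type_seq G ?P n v) \<longlonglongrightarrow> ?P v" by auto
  \<comment> \<open>For n \<ge> 1 the products are natural numbers by the definition of an n-type,
    so the floor merely recovers them.\<close>
  define c where "c n v = nat \<lfloor>real n * type_seq G ?P n v\<rfloor>" for n v
  have c: "real n * type_seq G ?P n v = real (c n v)" if "n \<ge> 1" "v < nv G" for n v
    using nt[OF that(1)] that(2) unfolding ntype_def c_def by (metis floor_of_nat nat_int)
  have "(\<Sum>v<nv G. c n v) = n" if n: "n \<ge> 1" for n
  proof -
    have "real (\<Sum>v<nv G. c n v) = real n * (\<Sum>v<nv G. type_seq G ?P n v)"
      using c[OF n] by (simp add: sum_distrib_left)
    also have "\<dots> = real n" using nt[OF n] by (simp add: ntype_def pdist_def)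
    finally show ?thesis by (simp only: of_nat_eq_iff)
  qed
  then have val: "f (type_graph G n (type_seq G ?P n)) = tval f {0..<nv G} (simeq G) (c n)"
    if "n \<ge> 1" for n
    using that c by (intro type_graph_tval f G) auto
  note ge1 = tval_ge_1[OF f _ reflp_simeq symp_simeq[OF G], of "{0..<nv G}"]
  have "(\<lambda>n. ln (tval f {0..<nv G} (simeq G) (c n)) / real n) \<longlonglongrightarrow> l / real N"
  proof (rule tval_limit_along_types[OF f _ reflp_simeq symp_simeq[OF G] _ _ N(2) l u l0])
    fix v assume "v \<in> {0..<nv G}"
    then have "(\<lambda>n. type_seq G ?P n v) \<longlonglongrightarrow> ?P v" using lim by simp
    moreover have "\<forall>\<^sub>F n in sequentially. type_seq G ?P n v = real (c n v) / real n"
      using eventually_ge_at_top[of 1]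
    proof eventually_elim
      case (elim n)
      then show ?case using c[OF elim, of v] \<open>v \<in> {0..<nv G}\<close> by (simp add: field_simps)
    qed
    ultimately show "(\<lambda>n. real (c n v) / real n) \<longlonglongrightarrow> real (a v) / real N"
      by (rule Lim_transform_eventually)
  qed (use a N in \<open>auto simp: atLeast0LessThan\<close>)
  then have "(\<lambda>n. exp (ln (tval f {0..<nv G} (simeq G) (c n)) / real n)) \<longlonglongrightarrow> exp (l / real N)"
    by (rule tendsto_exp)
  moreover have "\<forall>\<^sub>F n in sequentially. exp (ln (tval f {0..<nv G} (simeq G) (c n)) / real n)
      = root n (f (type_graph G n (type_seq G ?P n)))"
    using eventually_ge_at_top[of 1]
  proof eventually_elim
    case (elim n)
    have pos: "0 < tval f {0..<nv G} (simeq G) (c n)"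
      using ge1[of "c n"] by simp
    show ?case
      unfolding val[OF elim]
      using elim pos by (intro real_root_pos_unique[symmetric]) (auto simp flip: exp_of_nat_mult)
  qed
  ultimately have "(\<lambda>n. root n (f (type_graph G n (type_seq G ?P n)))) \<longlonglongrightarrow> exp (l / real N)"
    by (rule Lim_transform_eventually)
  then have "prob_ref f G ?P = exp (l / real N)"
    unfolding prob_ref_def by (rule limI)
  then show ?thesis by simp
qed

section \<open>Cohomomorphisms as families of isometries\<close>

text \<open>The first component is at once the block index, the colour and the fibre dimension, so
  \<open>fst\<close> can serve as dimension function.\<close>

definition cverts :: "graph list \<Rightarrow> (nat \<times> nat) set" where
  "cverts Gs = {(d, v). 1 \<le> d \<and> d \<le> length Gs \<and> v < nv (gr Gs d)}"

definition crel :: "graph list \<Rightarrow> nat \<times> nat \<Rightarrow> nat \<times> nat \<Rightarrow> bool" where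
  "crel Gs x y \<longleftrightarrow> fst x = fst y \<and> simeq (gr Gs (fst x)) (snd x) (snd y)"

lemma wf_gr: "wf_rep Gs \<Longrightarrow> wf_graph (gr Gs d)"
  by (auto simp: wf_rep_def gr_def)

lemma finite_cverts: "finite (cverts Gs)"
  by (rule finite_subset[of _ "SIGMA d:{1..length Gs}. {..<nv (gr Gs d)}"]) (auto simp: cverts_def)

lemma crel_refl: "crel Gs x x"
  by (simp add: crel_def simeq_def)

lemma crel_fst: "crel Gs x y \<Longrightarrow> fst x = fst y"
  by (simp add: crel_def)

lemma reflp_crel: "reflp (crel Gs)"
  by (simp add: reflp_def crel_refl)

lemma symp_crel:
  assumes "wf_rep Gs"
  shows "symp (crel Gs)"
proof (rule sympI)
  fix x y assume "crel Gs x y"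
  then show "crel Gs y x"
    using sympD[OF symp_simeq[OF wf_gr[OF assms, of "fst x"]]] by (auto simp: crel_def)
qed

section \<open>The standard basis in coordinates of vertices and fibres\<close>

lemma set_idxs: "set (idxs Gs) = (\<lambda>(x, l). (fst x, snd x, l)) ` (SIGMA x:cverts Gs. {..<fst x})"
  by (auto simp: idxs_def cverts_def image_iff)

lemma distinct_concat_map:
  assumes "distinct xs" "\<And>x. x \<in> set xs \<Longrightarrow> distinct (F x)"
    and "\<And>x y z. x \<in> set xs \<Longrightarrow> y \<in> set xs \<Longrightarrow> z \<in> set (F x) \<Longrightarrow> z \<in> set (F y) \<Longrightarrow> x = y"
  shows "distinct (concat (map F xs))"
  using assms
proof (induction xs)
  case (Cons x xs)
  have "distinct (concat (map F xs))"
    using Cons.prems by (intro Cons.IH) auto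
  moreover have "set (F x) \<inter> set (concat (map F xs)) = {}"
    using Cons.prems(1) Cons.prems(3)[of x] by fastforce
  ultimately show ?case using Cons.prems(2) by simp
qed simp

lemma distinct_idxs: "distinct (idxs Gs)"
  unfolding idxs_def
  by (intro distinct_concat_map distinct_upt) (auto simp: distinct_map inj_on_def)

text \<open>Inverse of the enumeration \<open>idxs\<close>. Matrix entries are from here on
  addressed by vertex and fibre coordinate; the order of the basis no longer enters, only
  bijectivity.\<close>

definition pos :: "graph list \<Rightarrow> nat \<times> nat \<Rightarrow> nat \<Rightarrow> nat" where
  "pos Gs x l = (SOME p. p < ncdim Gs \<and> idxs Gs ! p = (fst x, snd x, l))"

lemma pos:
  assumes "x \<in> cverts Gs" "l < fst x"
  shows "pos Gs x l < ncdim Gs" "idxs Gs ! pos Gs x l = (fst x, snd x, l)"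
proof -
  have "(fst x, snd x, l) \<in> set (idxs Gs)"
    unfolding set_idxs using assms by force
  then have "\<exists>p. p < ncdim Gs \<and> idxs Gs ! p = (fst x, snd x, l)"
    by (auto simp: in_set_conv_nth ncdim_def)
  from someI_ex[OF this]
  show "pos Gs x l < ncdim Gs" "idxs Gs ! pos Gs x l = (fst x, snd x, l)"
    by (simp_all add: pos_def)
qed

lemma bij_betw_pos:
  "bij_betw (\<lambda>(x, l). pos Gs x l) (SIGMA x:cverts Gs. {..<fst x}) {..<ncdim Gs}"
proof -
  have "inj_on (\<lambda>(x, l). pos Gs x l) (SIGMA x:cverts Gs. {..<fst x})"
  proof (rule inj_onI)
    fix s t assume h: "s \<in> (SIGMA x:cverts Gs. {..<fst x})" "t \<in> (SIGMA x:cverts Gs. {..<fst x})"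
      and eq: "(case s of (x, l) \<Rightarrow> pos Gs x l) = (case t of (x, l) \<Rightarrow> pos Gs x l)"
    obtain x l y k where st: "s = (x, l)" "t = (y, k)" by (metis surj_pair)
    have "(fst x, snd x, l) = (fst y, snd y, k)"
      using pos(2)[of x Gs l] pos(2)[of y Gs k] h eq unfolding st by simp
    then show "s = t" by (simp add: st prod_eq_iff)
  qed
  moreover have "p \<in> (\<lambda>(x, l). pos Gs x l) ` (SIGMA x:cverts Gs. {..<fst x})" if p: "p < ncdim Gs" for p
  proof -
    have "idxs Gs ! p \<in> set (idxs Gs)" using p by (simp add: ncdim_def)
    then obtain x l where xl: "x \<in> cverts Gs" "l < fst x" "idxs Gs ! p = (fst x, snd x, l)"
      unfolding set_idxs by auto
    then have "p = pos Gs x l"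
      using pos[OF xl(1,2)] p nth_eq_iff_index_eq[OF distinct_idxs[of Gs], of p "pos Gs x l"]
      by (simp add: ncdim_def)
    then show ?thesis using xl(1,2) by (intro image_eqI[of _ _ "(x, l)"]) auto
  qed
  ultimately show ?thesis
    unfolding bij_betw_def using pos(1) by (intro conjI equalityI subsetI) auto
qed

lemma pos_eq_iff:
  assumes "x \<in> cverts Gs" "l < fst x" "y \<in> cverts Gs" "k < fst y"
  shows "pos Gs x l = pos Gs y k \<longleftrightarrow> x = y \<and> l = k"
  using pos(2)[OF assms(1,2)] pos(2)[OF assms(3,4)] by (metis Pair_inject prod.collapse)

lemma pos_cases:
  assumes "p < ncdim Gs"
  obtains x l where "x \<in> cverts Gs" "l < fst x" "p = pos Gs x l"
proof -
  have "p \<in> (\<lambda>(x, l). pos Gs x l) ` (SIGMA x:cverts Gs. {..<fst x})"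
    using assms bij_betw_pos[of Gs] by (simp add: bij_betw_def)
  then show thesis using that by auto
qed

lemma sum_over_pos: "(\<Sum>p<ncdim Gs. F p) = (\<Sum>x\<in>cverts Gs. \<Sum>l<fst x. F (pos Gs x l))"
  by (simp add: sum.reindex_bij_betw[OF bij_betw_pos, symmetric] sum.Sigma finite_cverts case_prod_beta)

lemma ncmat_pos:
  assumes "x \<in> cverts Gs" "l < fst x" "y \<in> cverts Gs" "k < fst y"
  shows "ncmat Gs c $$ (pos Gs x l, pos Gs y k)
    = (if crel Gs x y \<and> l = k then c (fst x) (snd x) (snd y) else 0)"
  using pos[OF assms(1,2)] pos[OF assms(3,4)] by (auto simp: ncmat_def crel_def)

lemma ncmat_carrier: "ncmat Gs c \<in> carrier_mat (ncdim Gs) (ncdim Gs)"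
  by (simp add: ncmat_def)

lemma mat_adjoint_carrier:
  "E \<in> carrier_mat m k \<Longrightarrow> mat_adjoint E \<in> carrier_mat k m"
  by (auto simp: mat_adjoint_def mat_of_rows_def)

lemma mat_adjoint_index:
  fixes E :: "complex mat"
  assumes "E \<in> carrier_mat m k" "i < k" "j < m"
  shows "mat_adjoint E $$ (i, j) = cnj (E $$ (j, i))"
  using assms by (auto simp: mat_adjoint_def mat_of_rows_index)

lemma adjoint_mult_index:
  fixes E E' :: "complex mat"
  assumes "E \<in> carrier_mat m k" "E' \<in> carrier_mat m k" "i < k" "j < k"
  shows "(mat_adjoint E * E') $$ (i, j) = (\<Sum>p<m. cnj (E $$ (p, i)) * E' $$ (p, j))"
proof -
  have "(mat_adjoint E * E') $$ (i, j) = (\<Sum>p<m. mat_adjoint E $$ (i, p) * E' $$ (p, j))"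
    using assms mat_adjoint_carrier[OF assms(1)] by (simp add: scalar_prod_def atLeast0LessThan)
  then show ?thesis using assms by (simp add: mat_adjoint_index[OF assms(1)])
qed

lemma adjoint_mult_mult_index:
  fixes E E' X :: "complex mat"
  assumes "E \<in> carrier_mat m k" "X \<in> carrier_mat m m" "E' \<in> carrier_mat m k" "i < k" "j < k"
  shows "(mat_adjoint E * X * E') $$ (i, j)
    = (\<Sum>p<m. \<Sum>q<m. cnj (E $$ (p, i)) * X $$ (p, q) * E' $$ (q, j))"
proof -
  have "(mat_adjoint E * X * E') = mat_adjoint E * (X * E')"
    using assms mat_adjoint_carrier[OF assms(1)] by (intro assoc_mult_mat) auto
  moreover have "(X * E') $$ (p, j) = (\<Sum>q<m. X $$ (p, q) * E' $$ (q, j))" if "p < m" for p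
    using assms that by (simp add: scalar_prod_def atLeast0LessThan)
  ultimately show ?thesis
    using assms by (simp add: adjoint_mult_index[where m = m and k = k] sum_distrib_left mult.assoc)
qed

lemma foldr_mat_add:
  assumes "\<And>A. A \<in> set As \<Longrightarrow> A \<in> carrier_mat k k"
  shows "foldr (+) As (0\<^sub>m k k) \<in> carrier_mat k k \<and>
    (i < k \<longrightarrow> j < k \<longrightarrow> foldr (+) As (0\<^sub>m k k) $$ (i, j) = (\<Sum>A\<leftarrow>As. A $$ (i, j)))"
  using assms
proof (induction As)
  case (Cons A As)
  then have IH: "foldr (+) As (0\<^sub>m k k) \<in> carrier_mat k k"
    "i < k \<longrightarrow> j < k \<longrightarrow> foldr (+) As (0\<^sub>m k k) $$ (i, j) = (\<Sum>A\<leftarrow>As. A $$ (i, j))" by auto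
  then show ?case using Cons.prems by auto
qed simp

text \<open>Every vertex \<open>x\<close> carries an isometry \<open>A x\<close> from its fibre \<open>\<complex>\<^bsup>d x\<^esup>\<close>
  to the fibre over \<open>\<phi> x\<close>; \<open>c\<close> holds the scalars of the overlaps \<open>(A x)\<^sup>* (A y)\<close>.\<close>
definition isometric_family ::
  "'a set \<Rightarrow> ('a \<Rightarrow> 'a \<Rightarrow> bool) \<Rightarrow> ('a \<Rightarrow> nat) \<Rightarrow> ('b \<Rightarrow> 'b \<Rightarrow> bool) \<Rightarrow> ('b \<Rightarrow> nat) \<Rightarrow> ('a \<Rightarrow> 'b)
    \<Rightarrow> ('a \<Rightarrow> nat \<Rightarrow> nat \<Rightarrow> complex) \<Rightarrow> ('a \<Rightarrow> 'a \<Rightarrow> complex) \<Rightarrow> bool" where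
  "isometric_family V R d S e \<phi> A c \<longleftrightarrow> (\<forall>x\<in>V. c x x = 1) \<and>
     (\<forall>x\<in>V. \<forall>y\<in>V. S (\<phi> x) (\<phi> y) \<longrightarrow> (\<forall>k<d x. \<forall>k'<d y.
        (\<Sum>l<e (\<phi> x). cnj (A x l k) * A y l k') = (if R x y \<and> k = k' then c x y else 0)))"

lemma sum_single:
  fixes F :: "'a \<Rightarrow> complex"
  assumes "finite X" "a \<in> X" "\<And>x. x \<in> X \<Longrightarrow> x \<noteq> a \<Longrightarrow> F x = 0"
  shows "sum F X = F a"
  using assms by (simp add: sum.remove[of X a F])

text \<open>There is one Kraus operator per vertex x: it acts as \<open>A x\<close> from the fibre
  over x to that over \<phi> x and vanishes elsewhere. The isometry condition gives the
  normalisation, and a compression of an element of S is a multiple of one overlap, which is scalar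
  on related vertices and zero on unrelated ones.\<close>

lemma ncg_leI:
  assumes \<phi>: "\<phi> ` cverts Ts \<subseteq> cverts Ss"
    and iso: "isometric_family (cverts Ts) (crel Ts) fst (crel Ss) fst \<phi> A c"
  shows "ncg_le Ts Ss"
proof -
  have gram: "(\<Sum>l<fst (\<phi> x). cnj (A x l k) * A y l k') = (if crel Ts x y \<and> k = k' then c x y else 0)"
    if "x \<in> cverts Ts" "y \<in> cverts Ts" "crel Ss (\<phi> x) (\<phi> y)" "k < fst x" "k' < fst y" for x y k k'
    using iso that unfolding isometric_family_def by blast
  have c1: "c x x = 1" if "x \<in> cverts Ts" for x
    using iso that unfolding isometric_family_def by blast
  have \<phi>': "\<phi> x \<in> cverts Ss" if "x \<in> cverts Ts" for x using \<phi> that by blast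
  define E where "E x = mat (ncdim Ss) (ncdim Ts) (\<lambda>(p, q).
    case (idxs Ss ! p, idxs Ts ! q) of ((d', w, l), (d, v, k)) \<Rightarrow>
      if (d, v) = x \<and> (d', w) = \<phi> x then A x l k else 0)" for x
  have Ec: "E x \<in> carrier_mat (ncdim Ss) (ncdim Ts)" for x by (simp add: E_def)
  have E: "E x $$ (pos Ss w l, pos Ts v k) = (if v = x \<and> w = \<phi> x then A x l k else 0)"
    if "w \<in> cverts Ss" "l < fst w" "v \<in> cverts Ts" "k < fst v" for x w l v k
    using pos[OF that(1,2)] pos[OF that(3,4)] by (auto simp: E_def)
  obtain xs where xs: "set xs = cverts Ts" "distinct xs"
    using finite_distinct_list[OF finite_cverts] by blast
  \<comment> \<open>The sums over the basis of \<open>Ss\<close> collapse to the fibres over \<phi>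
    x and \<phi> y, outside which the rows of \<open>E x\<close> and \<open>E y\<close>
    vanish.\<close>
  have sandwich: "(mat_adjoint (E x) * X * E y) $$ (pos Ts v k, pos Ts v' k')
      = (if v = x \<and> v' = y then \<Sum>l<fst (\<phi> x). \<Sum>l'<fst (\<phi> y). cnj (A x l k) *
           X $$ (pos Ss (\<phi> x) l, pos Ss (\<phi> y) l') * A y l' k' else 0)"
    if x: "x \<in> cverts Ts" "y \<in> cverts Ts" and v: "v \<in> cverts Ts" "k < fst v" "v' \<in> cverts Ts" "k' < fst v'"
      and X: "X \<in> carrier_mat (ncdim Ss) (ncdim Ss)" for x y X v k v' k'
  proof -
    let ?t = "\<lambda>w l w' l'. cnj (E x $$ (pos Ss w l, pos Ts v k)) *
        X $$ (pos Ss w l, pos Ss w' l') * E y $$ (pos Ss w' l', pos Ts v' k')"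
    have "(mat_adjoint (E x) * X * E y) $$ (pos Ts v k, pos Ts v' k')
        = (\<Sum>w\<in>cverts Ss. \<Sum>l<fst w. \<Sum>w'\<in>cverts Ss. \<Sum>l'<fst w'. ?t w l w' l')"
      using pos(1) v by (simp add: adjoint_mult_mult_index[OF Ec X Ec] sum_over_pos)
    also have "\<dots> = (\<Sum>l<fst (\<phi> x). \<Sum>w'\<in>cverts Ss. \<Sum>l'<fst w'. ?t (\<phi> x) l w' l')"
      using v by (intro sum_single finite_cverts \<phi>' x) (auto simp: E intro!: sum.neutral)
    also have "\<dots> = (\<Sum>l<fst (\<phi> x). \<Sum>l'<fst (\<phi> y). ?t (\<phi> x) l (\<phi> y) l')"
      using v by (intro sum.cong refl sum_single finite_cverts \<phi>' x) (auto simp: E intro!: sum.neutral)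
    also have "\<dots> = (\<Sum>l<fst (\<phi> x). \<Sum>l'<fst (\<phi> y). if v = x \<and> v' = y then cnj (A x l k) *
           X $$ (pos Ss (\<phi> x) l, pos Ss (\<phi> y) l') * A y l' k' else 0)"
      using v x \<phi>' by (intro sum.cong refl) (auto simp: E)
    finally show ?thesis by auto
  qed
  have "foldr (+) (map (\<lambda>E. mat_adjoint E * E) (map E xs)) (0\<^sub>m (ncdim Ts) (ncdim Ts)) = 1\<^sub>m (ncdim Ts)"
    (is "?M = _")
  proof (rule eq_matI)
    have carr: "B \<in> carrier_mat (ncdim Ts) (ncdim Ts)"
      if "B \<in> set (map (\<lambda>E. mat_adjoint E * E) (map E xs))" for B
      using that mult_carrier_mat[OF mat_adjoint_carrier[OF Ec] Ec] by auto
    note fm = foldr_mat_add[of "map (\<lambda>E. mat_adjoint E * E) (map E xs)" "ncdim Ts", OF carr]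
    show "dim_row ?M = dim_row (1\<^sub>m (ncdim Ts))" "dim_col ?M = dim_col (1\<^sub>m (ncdim Ts))"
      using fm by auto
    fix i j assume ij: "i < dim_row (1\<^sub>m (ncdim Ts))" "j < dim_col (1\<^sub>m (ncdim Ts))"
    obtain v k where v: "v \<in> cverts Ts" "k < fst v" "i = pos Ts v k"
      using ij pos_cases[of i Ts] by auto
    obtain v' k' where v': "v' \<in> cverts Ts" "k' < fst v'" "j = pos Ts v' k'"
      using ij pos_cases[of j Ts] by auto
    have entry: "(mat_adjoint (E x) * E x) $$ (i, j) = (if x = v then if v = v' \<and> k = k' then 1 else 0 else 0)"
      if x: "x \<in> cverts Ts" for x
    proof -
      have "(mat_adjoint (E x) * E x) $$ (i, j) = (\<Sum>w\<in>cverts Ss. \<Sum>l<fst w.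
          cnj (E x $$ (pos Ss w l, i)) * E x $$ (pos Ss w l, j))"
        using ij by (simp add: adjoint_mult_index[OF Ec Ec] sum_over_pos)
      also have "\<dots> = (\<Sum>l<fst (\<phi> x). cnj (E x $$ (pos Ss (\<phi> x) l, i)) * E x $$ (pos Ss (\<phi> x) l, j))"
        using v v' by (intro sum_single finite_cverts \<phi>' x) (auto simp: E intro!: sum.neutral)
      also have "\<dots> = (if v = x \<and> v' = x then \<Sum>l<fst (\<phi> x). cnj (A x l k) * A x l k' else 0)"
        using v v' x \<phi>' by (auto simp: E intro!: sum.neutral)
      also have "\<dots> = (if x = v then if v = v' \<and> k = k' then 1 else 0 else 0)"
        using gram[OF x x crel_refl, of k k'] v v' c1[OF x] by (auto simp: crel_refl)
      finally show ?thesis .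
    qed
    have "?M $$ (i, j) = (\<Sum>x\<leftarrow>xs. (mat_adjoint (E x) * E x) $$ (i, j))"
      using fm ij by (simp add: comp_def)
    also have "\<dots> = (\<Sum>x\<in>cverts Ts. (mat_adjoint (E x) * E x) $$ (i, j))"
      using xs by (simp add: sum_list_distinct_conv_sum_set)
    also have "\<dots> = (if v = v' \<and> k = k' then 1 else 0)"
      using v(1) entry by (simp add: finite_cverts)
    also have "\<dots> = 1\<^sub>m (ncdim Ts) $$ (i, j)"
      using ij v v' pos_eq_iff[of v Ts k v' k'] by auto
    finally show "?M $$ (i, j) = 1\<^sub>m (ncdim Ts) $$ (i, j)" .
  qed
  moreover have "mat_adjoint (E x) * ncmat Ss g * E y \<in> ncg Ts"
    if x: "x \<in> cverts Ts" "y \<in> cverts Ts" for x y g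
  proof -
    \<comment> \<open>The compression has at most one nonzero block, at (x, y): the coefficient of
      the matrix at (\<phi> x, \<phi> y) times the overlap scalar. If the images are unrelated, that
      coefficient block is already zero.\<close>
    define g' where "g' d v v' = (if (d, v) = x \<and> (d, v') = y \<and> crel Ss (\<phi> x) (\<phi> y)
      then g (fst (\<phi> x)) (snd (\<phi> x)) (snd (\<phi> y)) * c x y else 0)" for d v v'
    have "mat_adjoint (E x) * ncmat Ss g * E y = ncmat Ts g'"
    proof (rule eq_matI)
      show "dim_row (mat_adjoint (E x) * ncmat Ss g * E y) = dim_row (ncmat Ts g')"
        "dim_col (mat_adjoint (E x) * ncmat Ss g * E y) = dim_col (ncmat Ts g')"
        using mat_adjoint_carrier[OF Ec, of x] Ec[of y] ncmat_carrier[of Ts g'] by auto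
      fix i j assume ij: "i < dim_row (ncmat Ts g')" "j < dim_col (ncmat Ts g')"
      have ij': "i < ncdim Ts" "j < ncdim Ts" using ij ncmat_carrier[of Ts g'] by auto
      obtain v k where v: "v \<in> cverts Ts" "k < fst v" "i = pos Ts v k"
        using ij' pos_cases[of i Ts] by auto
      obtain v' k' where v': "v' \<in> cverts Ts" "k' < fst v'" "j = pos Ts v' k'"
        using ij' pos_cases[of j Ts] by auto
      define \<gamma> where "\<gamma> = g (fst (\<phi> x)) (snd (\<phi> x)) (snd (\<phi> y))"
      have "(\<Sum>l<fst (\<phi> x). \<Sum>l'<fst (\<phi> y). cnj (A x l k) *
           ncmat Ss g $$ (pos Ss (\<phi> x) l, pos Ss (\<phi> y) l') * A y l' k')
          = (\<Sum>l<fst (\<phi> x). \<Sum>l'<fst (\<phi> y). if l' = l then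
              (if crel Ss (\<phi> x) (\<phi> y) then cnj (A x l k) * \<gamma> * A y l' k' else 0) else 0)"
        using \<phi>' x by (intro sum.cong refl) (simp add: ncmat_pos \<gamma>_def)
      also have "\<dots> = (if crel Ss (\<phi> x) (\<phi> y) then \<gamma> * (\<Sum>l<fst (\<phi> x). cnj (A x l k) * A y l k') else 0)"
      proof (cases "crel Ss (\<phi> x) (\<phi> y)")
        case True
        then have "fst (\<phi> x) = fst (\<phi> y)" by (simp add: crel_def)
        then show ?thesis using True by (simp add: sum_distrib_left mult_ac)
      qed simp
      finally have "(mat_adjoint (E x) * ncmat Ss g * E y) $$ (i, j) = (if v = x \<and> v' = y then
          if crel Ss (\<phi> x) (\<phi> y) then \<gamma> * (\<Sum>l<fst (\<phi> x). cnj (A x l k) * A y l k') else 0 else 0)"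
        using sandwich[OF x v(1,2) v'(1,2) ncmat_carrier] v v' by simp
      also have "\<dots> = ncmat Ts g' $$ (i, j)"
      proof -
        have "g' (fst v) (snd v) (snd v') = (if v = x \<and> v' = y \<and> crel Ss (\<phi> x) (\<phi> y) then \<gamma> * c x y else 0)"
          if "crel Ts v v'"
          using that by (auto simp: g'_def \<gamma>_def crel_def prod_eq_iff)
        then show ?thesis
          using gram[OF x, of k k'] v v' by (auto simp: ncmat_pos)
      qed
      finally show "(mat_adjoint (E x) * ncmat Ss g * E y) $$ (i, j) = ncmat Ts g' $$ (i, j)" .
    qed
    then show ?thesis by (auto simp: ncg_def)
  qed
  ultimately show ?thesis
    unfolding ncg_le_def cohom_def
    using xs Ec by (intro exI[of _ "map E xs"]) (auto simp: ncg_def)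
qed

text \<open>Some Kraus operator has a nonzero block between the fibre of \<open>x\<close> and the fibre of some
  \<open>\<phi> x\<close>.  Sandwiching the matrix unit of \<open>\<phi> x\<close> shows that this block is a
  multiple of an isometry, so it alone can replace all Kraus operators on the fibre of \<open>x\<close>.\<close>
lemma ncg_leE:
  assumes "ncg_le Ts Ss"
  obtains \<phi> A c where "\<phi> ` cverts Ts \<subseteq> cverts Ss"
    "isometric_family (cverts Ts) (crel Ts) fst (crel Ss) fst \<phi> A c"
proof -
  obtain Es where Ec: "\<And>E. E \<in> set Es \<Longrightarrow> E \<in> carrier_mat (ncdim Ss) (ncdim Ts)"
    and one: "foldr (+) (map (\<lambda>E. mat_adjoint E * E) Es) (0\<^sub>m (ncdim Ts) (ncdim Ts)) = 1\<^sub>m (ncdim Ts)"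
    and sub: "\<And>E E' X. E \<in> set Es \<Longrightarrow> E' \<in> set Es \<Longrightarrow> X \<in> ncg Ss \<Longrightarrow> mat_adjoint E * X * E' \<in> ncg Ts"
    using assms unfolding ncg_le_def cohom_def by blast
  \<comment> \<open>Otherwise the column at fibre coordinate 0 over x would vanish in every Kraus
    operator, and with it a diagonal entry of their normalisation sum, which is 1. The coordinate
    exists because colours start at 1.\<close>
  have "\<exists>E w l. E \<in> set Es \<and> w \<in> cverts Ss \<and> l < fst w \<and> E $$ (pos Ss w l, pos Ts x 0) \<noteq> 0"
    if x: "x \<in> cverts Ts" for x
  proof (rule ccontr)
    assume "\<not> ?thesis"
    then have zero: "E $$ (pos Ss w l, pos Ts x 0) = 0" if "E \<in> set Es" "w \<in> cverts Ss" "l < fst w" for E w l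
      using that by blast
    have q: "pos Ts x 0 < ncdim Ts" using pos(1)[OF x, of 0] x by (auto simp: cverts_def)
    have carr: "B \<in> carrier_mat (ncdim Ts) (ncdim Ts)" if "B \<in> set (map (\<lambda>E. mat_adjoint E * E) Es)" for B
      using that mult_carrier_mat[OF mat_adjoint_carrier[OF Ec] Ec] by auto
    have "(1::complex) = 1\<^sub>m (ncdim Ts) $$ (pos Ts x 0, pos Ts x 0)" using q by simp
    also have "\<dots> = (\<Sum>B\<leftarrow>map (\<lambda>E. mat_adjoint E * E) Es. B $$ (pos Ts x 0, pos Ts x 0))"
      unfolding one[symmetric] using foldr_mat_add[OF carr] q by blast
    also have "\<dots> = (\<Sum>E\<leftarrow>Es. 0)"
      unfolding map_map comp_def
    proof (intro arg_cong[where f = sum_list] map_cong refl)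
      fix E assume E: "E \<in> set Es"
      show "(mat_adjoint E * E) $$ (pos Ts x 0, pos Ts x 0) = 0"
        using E zero q by (simp add: adjoint_mult_index[OF Ec Ec] sum_over_pos)
    qed
    finally show False by simp
  qed
  then obtain E \<phi> m where E: "\<And>x. x \<in> cverts Ts \<Longrightarrow> E x \<in> set Es"
    and \<phi>: "\<And>x. x \<in> cverts Ts \<Longrightarrow> \<phi> x \<in> cverts Ss" and m: "\<And>x. x \<in> cverts Ts \<Longrightarrow> m x < fst (\<phi> x)"
    and nz: "\<And>x. x \<in> cverts Ts \<Longrightarrow> E x $$ (pos Ss (\<phi> x) (m x), pos Ts x 0) \<noteq> 0"
    by metis
  define B where "B x l k = E x $$ (pos Ss (\<phi> x) l, pos Ts x k)" for x l k
  define gram where "gram x y k k' = (\<Sum>l<fst (\<phi> x). cnj (B x l k) * B y l k')" for x y k k'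
  have gram: "\<exists>C. \<forall>k<fst x. \<forall>k'<fst y. gram x y k k' = (if crel Ts x y \<and> k = k' then C else 0)"
    if x: "x \<in> cverts Ts" "y \<in> cverts Ts" and rel: "crel Ss (\<phi> x) (\<phi> y)" for x y
  proof -
    \<comment> \<open>This element of S is the matrix unit from \<phi> y to \<phi> x tensored with
      the identity of the fibre; compressing it by \<open>E x\<close> and \<open>E y\<close> leaves
      exactly the Gram matrix of the chosen blocks.\<close>
    define g :: "nat \<Rightarrow> nat \<Rightarrow> nat \<Rightarrow> complex"
      where "g d w w' = (if (d, w) = \<phi> x \<and> (d, w') = \<phi> y then 1 else 0)" for d w w'
    have d: "fst (\<phi> x) = fst (\<phi> y)" using rel by (simp add: crel_def)
    have g: "ncmat Ss g $$ (pos Ss w l, pos Ss w' l') = (if w = \<phi> x then if w' = \<phi> y then if l = l' then 1 else 0 else 0 else 0)"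
      if "w \<in> cverts Ss" "l < fst w" "w' \<in> cverts Ss" "l' < fst w'" for w l w' l'
      using that rel d by (auto simp: ncmat_pos g_def crel_def prod_eq_iff)
    have "mat_adjoint (E x) * ncmat Ss g * E y \<in> ncg Ts"
      using sub[OF E[OF x(1)] E[OF x(2)], of "ncmat Ss g"] by (simp add: ncg_def)
    then obtain h where h: "mat_adjoint (E x) * ncmat Ss g * E y = ncmat Ts h"
      unfolding ncg_def by blast
    have "gram x y k k' = (if crel Ts x y \<and> k = k' then h (fst x) (snd x) (snd y) else 0)"
      if k: "k < fst x" "k' < fst y" for k k'
    proof -
      let ?t = "\<lambda>w l w' l'. cnj (E x $$ (pos Ss w l, pos Ts x k)) *
        ncmat Ss g $$ (pos Ss w l, pos Ss w' l') * E y $$ (pos Ss w' l', pos Ts y k')"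
      have "ncmat Ts h $$ (pos Ts x k, pos Ts y k')
          = (\<Sum>w\<in>cverts Ss. \<Sum>l<fst w. \<Sum>w'\<in>cverts Ss. \<Sum>l'<fst w'. ?t w l w' l')"
        unfolding h[symmetric] using pos(1) x k
        by (simp add: adjoint_mult_mult_index[OF Ec[OF E[OF x(1)]] ncmat_carrier Ec[OF E[OF x(2)]]] sum_over_pos)
      also have "\<dots> = (\<Sum>l<fst (\<phi> x). \<Sum>w'\<in>cverts Ss. \<Sum>l'<fst w'. ?t (\<phi> x) l w' l')"
        by (intro sum_single finite_cverts \<phi> x) (auto simp: g intro!: sum.neutral)
      also have "\<dots> = (\<Sum>l<fst (\<phi> x). \<Sum>l'<fst (\<phi> y). ?t (\<phi> x) l (\<phi> y) l')"
        using \<phi>[OF x(1)]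
        by (intro sum.cong refl sum_single finite_cverts \<phi> x) (auto simp: g intro!: sum.neutral)
      also have "\<dots> = (\<Sum>l<fst (\<phi> x). \<Sum>l'<fst (\<phi> y). if l' = l then cnj (B x l k) * B y l k' else 0)"
        using \<phi> x by (intro sum.cong refl) (simp add: g B_def)
      also have "\<dots> = gram x y k k'"
        by (simp add: gram_def d)
      finally show ?thesis using ncmat_pos[OF x(1) k(1) x(2) k(2), of h] by simp
    qed
    then show ?thesis by blast
  qed
  then obtain C where C: "\<And>x y k k'. x \<in> cverts Ts \<Longrightarrow> y \<in> cverts Ts \<Longrightarrow> crel Ss (\<phi> x) (\<phi> y) \<Longrightarrow>
      k < fst x \<Longrightarrow> k' < fst y \<Longrightarrow> gram x y k k' = (if crel Ts x y \<and> k = k' then C x y else 0)"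
    by metis
  \<comment> \<open>The squared norm of the first column of \<open>B x\<close> equals the scalar of
    the Gram matrix of \<open>B x\<close>. It is positive because of the chosen nonzero entry, so
    dividing by its root gives an isometry.\<close>
  define r where "r x = (\<Sum>l<fst (\<phi> x). (cmod (B x l 0))\<^sup>2)" for x
  have r: "r x > 0" "C x x = of_real (r x)" if x: "x \<in> cverts Ts" for x
  proof -
    show "r x > 0"
      unfolding r_def using m[OF x] nz[OF x] by (intro sum_pos2[of _ "m x"]) (auto simp: B_def)
    have "0 < fst x" using x by (auto simp: cverts_def)
    then have "C x x = gram x x 0 0" using C[OF x x crel_refl, of 0 0] by (simp add: crel_refl)
    also have "\<dots> = of_real (r x)"
      unfolding gram_def r_def of_real_sum
      by (intro sum.cong refl) (simp add: complex_norm_square mult.commute del: of_real_power)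
    finally show "C x x = of_real (r x)" .
  qed
  define A where "A x l k = B x l k / of_real (sqrt (r x))" for x l k
  define c where "c x y = C x y / of_real (sqrt (r x) * sqrt (r y))" for x y
  have "isometric_family (cverts Ts) (crel Ts) fst (crel Ss) fst \<phi> A c"
    unfolding isometric_family_def
  proof (intro conjI ballI impI allI)
    fix x assume x: "x \<in> cverts Ts"
    then show "c x x = 1" using r[OF x] by (simp add: c_def)
  next
    fix x y k k' assume h: "x \<in> cverts Ts" "y \<in> cverts Ts" "crel Ss (\<phi> x) (\<phi> y)" "k < fst x" "k' < fst y"
    have "(\<Sum>l<fst (\<phi> x). cnj (A x l k) * A y l k')
        = gram x y k k' / of_real (sqrt (r x) * sqrt (r y))"
      by (simp add: A_def gram_def sum_divide_distrib)
    then show "(\<Sum>l<fst (\<phi> x). cnj (A x l k) * A y l k') = (if crel Ts x y \<and> k = k' then c x y else 0)"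
      using C[OF h] by (simp add: c_def)
  qed
  moreover have "\<phi> ` cverts Ts \<subseteq> cverts Ss" using \<phi> by blast
  ultimately show thesis using that by blast
qed

section \<open>Tensor powers of isometric families\<close>

lemma sum_div_mod:
  "(\<Sum>i<m * n. F (i div n) (i mod n)) = (\<Sum>q<m. \<Sum>r<(n::nat). F q r)"
  using sum.reindex_bij_betw[OF bij_betw_div_mod, of "\<lambda>(q, r). F q r" n m]
  by (simp add: atLeast0LessThan sum.cartesian_product)

text \<open>Kronecker product of the matrices \<open>A x\<close> of size \<open>e x \<times> d x\<close>, with the same index
  convention as for strong products.\<close>
primrec tensor :: "('a \<Rightarrow> nat) \<Rightarrow> ('a \<Rightarrow> nat) \<Rightarrow> ('a \<Rightarrow> nat \<Rightarrow> nat \<Rightarrow> complex) \<Rightarrow> 'a list \<Rightarrow> nat \<Rightarrow> nat \<Rightarrow> complex"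
  where
    "tensor e d A [] l k = 1"
  | "tensor e d A (x # xs) l k =
       A x (l div prod_list (map e xs)) (k div prod_list (map d xs)) *
       tensor e d A xs (l mod prod_list (map e xs)) (k mod prod_list (map d xs))"

text \<open>Overlaps of Kronecker products are products of overlaps: splitting the row index into
  quotient and remainder factors the sum, and the induction treats one tensor factor at a
  time.\<close>

lemma tensor_gram:
  assumes iso: "isometric_family V R d S e \<phi> A c"
    and R: "\<And>x y. R x y \<Longrightarrow> d x = d y" and S: "\<And>x y. S x y \<Longrightarrow> e x = e y"
    and "list_all2 (\<lambda>x y. S (\<phi> x) (\<phi> y)) xs ys" "set xs \<subseteq> V" "set ys \<subseteq> V"
    and "k < prod_list (map d xs)" "k' < prod_list (map d ys)"
  shows "(\<Sum>l<prod_list (map (e \<circ> \<phi>) xs). cnj (tensor (e \<circ> \<phi>) d A xs l k) * tensor (e \<circ> \<phi>) d A ys l k')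
    = (if list_all2 R xs ys \<and> k = k' then prod_list (map2 c xs ys) else 0)"
  using assms(4-)
proof (induction xs ys arbitrary: k k' rule: list_all2_induct)
  case Nil
  then show ?case by simp
next
  case (Cons x xs y ys)
  let ?E = "prod_list (map (e \<circ> \<phi>) xs)"
  let ?D = "prod_list (map d xs)" and ?D' = "prod_list (map d ys)"
  let ?T = "tensor (e \<circ> \<phi>) d A"
  have "map (e \<circ> \<phi>) xs = map (e \<circ> \<phi>) ys"
    using Cons.hyps(2) by (induction rule: list_all2_induct) (auto dest: S)
  then have E: "prod_list (map (e \<circ> \<phi>) ys) = ?E" by simp
  have D: "0 < ?D" "0 < ?D'"
    using Cons.prems by (auto intro!: gr0I)
  have k: "k div ?D < d x" "k mod ?D < ?D" "k' div ?D' < d y" "k' mod ?D' < ?D'"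
    using Cons.prems D by (auto simp: less_mult_imp_div_less)
  define F where "F q r = (cnj (A x q (k div ?D)) * A y q (k' div ?D')) *
      (cnj (?T xs r (k mod ?D)) * ?T ys r (k' mod ?D'))" for q r
  have "(\<Sum>l<prod_list (map (e \<circ> \<phi>) (x # xs)). cnj (?T (x # xs) l k) * ?T (y # ys) l k')
      = (\<Sum>l<e (\<phi> x) * ?E. F (l div ?E) (l mod ?E))"
    by (simp add: E F_def mult_ac)
  also have "\<dots> = (\<Sum>q<e (\<phi> x). cnj (A x q (k div ?D)) * A y q (k' div ?D')) *
      (\<Sum>r<?E. cnj (?T xs r (k mod ?D)) * ?T ys r (k' mod ?D'))"
    unfolding sum_div_mod by (simp add: sum_product F_def)
  also have "(\<Sum>q<e (\<phi> x). cnj (A x q (k div ?D)) * A y q (k' div ?D'))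
      = (if R x y \<and> k div ?D = k' div ?D' then c x y else 0)"
    using iso Cons.hyps(1) Cons.prems(1,2) k unfolding isometric_family_def by simp
  also have "(\<Sum>r<?E. cnj (?T xs r (k mod ?D)) * ?T ys r (k' mod ?D'))
      = (if list_all2 R xs ys \<and> k mod ?D = k' mod ?D' then prod_list (map2 c xs ys) else 0)"
    using Cons.prems k by (intro Cons.IH) auto
  finally have eq: "(\<Sum>l<prod_list (map (e \<circ> \<phi>) (x # xs)). cnj (?T (x # xs) l k) * ?T (y # ys) l k')
      = (if R x y \<and> k div ?D = k' div ?D' then c x y else 0) *
        (if list_all2 R xs ys \<and> k mod ?D = k' mod ?D' then prod_list (map2 c xs ys) else 0)" .
  \<comment> \<open>The column indices are split with the possibly different radices
    \<open>?D\<close> and \<open>?D'\<close>. For related lists the radices agree, so equality of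
    the index pairs means k = k'; for unrelated lists both sides are 0.\<close>
  show ?case
  proof (cases "R x y \<and> list_all2 R xs ys")
    case True
    then have "map d xs = map d ys"
      by (auto simp: list_all2_conv_all_nth intro!: nth_equalityI R)
    then have "?D = ?D'" by simp
    then have "k = k' \<longleftrightarrow> k div ?D = k' div ?D' \<and> k mod ?D = k' mod ?D'"
      by (metis div_mult_mod_eq)
    then show ?thesis unfolding eq using True by auto
  next
    case False
    then show ?thesis unfolding eq by auto
  qed
qed

text \<open>Represents G \<otimes> C_D, the block sitting at position D of the list. The lemmas
  locating G assume D \<ge> 1, since truncated subtraction makes the case D = 0 coincide with D =
  1.\<close>

definition block :: "nat \<Rightarrow> graph \<Rightarrow> graph list" where
  "block D G = replicate (D - 1) empty_graph @ [G]"

lemma length_block: "D \<ge> 1 \<Longrightarrow> length (block D G) = D"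
  by (simp add: block_def)

lemma gr_block: "D \<ge> 1 \<Longrightarrow> gr (block D G) d = (if d = D then G else empty_graph)"
  by (auto simp: gr_def length_block) (auto simp: block_def nth_append)

lemma wf_block: "wf_graph G \<Longrightarrow> wf_rep (block D G)"
  by (auto simp: wf_rep_def block_def)

lemma cverts_block: "D \<ge> 1 \<Longrightarrow> cverts (block D G) = {D} \<times> {0..<nv G}"
  by (auto simp: cverts_def gr_block length_block split: if_splits)

lemma crel_block: "D \<ge> 1 \<Longrightarrow> crel (block D G) (D, i) (D, j) \<longleftrightarrow> simeq G i j"
  by (simp add: crel_def gr_block)

text \<open>Positions past the end of the list are empty graphs of value 0, so lists of different
  lengths can be summed over a common range.\<close>

lemma falpha_conv_gr:
  assumes "DeltaG f" "length Gs \<le> M"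
  shows "falpha f \<alpha> Gs = (\<Sum>d\<in>{1..M}. f (gr Gs d) * real d powr \<alpha>)"
proof -
  have "falpha f \<alpha> Gs = (\<Sum>d\<in>{1..length Gs}. f (gr Gs d) * real d powr \<alpha>)"
    unfolding falpha_def
    by (rule sum.reindex_bij_witness[where i = "\<lambda>d. d - 1" and j = Suc]) (auto simp: gr_def)
  also have "\<dots> = (\<Sum>d\<in>{1..M}. f (gr Gs d) * real d powr \<alpha>)"
    using assms by (intro sum.mono_neutral_left) (auto simp: gr_def DeltaG_empty)
  finally show ?thesis .
qed

lemma falpha_block:
  assumes "DeltaG f" "D \<ge> 1"
  shows "falpha f \<alpha> (block D G) = f G * real D powr \<alpha>"
proof -
  have "falpha f \<alpha> (block D G) = (\<Sum>d\<in>{1..D}. f (gr (block D G) d) * real d powr \<alpha>)"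
    using assms by (intro falpha_conv_gr) (auto simp: length_block)
  also have "\<dots> = (\<Sum>d\<in>{1..D}. if d = D then f G * real D powr \<alpha> else 0)"
    using assms by (intro sum.cong) (auto simp: gr_block DeltaG_empty)
  finally show ?thesis using assms(2) by simp
qed

lemma DeltaA_mono: "DeltaA F \<Longrightarrow> wf_rep Gs \<Longrightarrow> wf_rep Hs \<Longrightarrow> ncg_le Gs Hs \<Longrightarrow> F Gs \<le> F Hs"
  by (simp add: DeltaA_def)

text \<open>This is where monotonicity of f_\<alpha> enters. With constant fibre dimensions both
  sides are single blocks, on which f_\<alpha> is f(G) * D^\<alpha>; the abstract vertex sets are
  carried to canonical copies because representatives live on natural numbers.\<close>

lemma isometric_family_gval_le:
  assumes f: "DeltaG f" and mono: "DeltaA (falpha f \<alpha>)"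
    and X: "finite X" "reflp R" "symp R" and Y: "finite Y" "reflp S" "symp S"
    and D: "D \<ge> 1" "D' \<ge> 1" and \<phi>: "\<phi> ` X \<subseteq> Y"
    and iso: "isometric_family X R (\<lambda>_. D) S (\<lambda>_. D') \<phi> A c"
  shows "gval f X R * real D powr \<alpha> \<le> gval f Y S * real D' powr \<alpha>"
proof -
  let ?G = "canon X (\<lambda>x y. x \<noteq> y \<and> R x y)" and ?H = "canon Y (\<lambda>x y. x \<noteq> y \<and> S x y)"
  obtain \<beta> where \<beta>: "bij_betw \<beta> {0..<card X} X"
    "\<And>i j. i < card X \<Longrightarrow> j < card X \<Longrightarrow> simeq ?G i j \<longleftrightarrow> R (\<beta> i) (\<beta> j)"
    "nv ?G = card X" "wf_graph ?G"
    using canon_presentation[OF X] by blast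
  obtain \<delta> where \<delta>: "bij_betw \<delta> {0..<card Y} Y"
    "\<And>i j. i < card Y \<Longrightarrow> j < card Y \<Longrightarrow> simeq ?H i j \<longleftrightarrow> S (\<delta> i) (\<delta> j)"
    "nv ?H = card Y" "wf_graph ?H"
    using canon_presentation[OF Y] by blast
  define \<psi> where "\<psi> i = inv_into {0..<card Y} \<delta> (\<phi> (\<beta> i))" for i
  have \<beta>X: "\<beta> i \<in> X" if "i < card X" for i
    using \<beta>(1) that by (auto simp: bij_betw_def)
  have im: "\<phi> (\<beta> i) \<in> \<delta> ` {0..<card Y}" if "i < card X" for i
    using \<beta>X[OF that] \<phi> \<delta>(1) by (auto simp: bij_betw_def)
  have \<psi>: "\<psi> i < card Y" "\<delta> (\<psi> i) = \<phi> (\<beta> i)" if "i < card X" for i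
    using inv_into_into[OF im[OF that]] f_inv_into_f[OF im[OF that]] by (simp_all add: \<psi>_def)
  have "ncg_le (block D ?G) (block D' ?H)"
  proof (rule ncg_leI[where \<phi> = "\<lambda>x. (D', \<psi> (snd x))" and A = "\<lambda>x. A (\<beta> (snd x))"
        and c = "\<lambda>x y. c (\<beta> (snd x)) (\<beta> (snd y))"])
    show "(\<lambda>x. (D', \<psi> (snd x))) ` cverts (block D ?G) \<subseteq> cverts (block D' ?H)"
      using \<psi>(1) D by (auto simp: cverts_block \<beta>(3) \<delta>(3))
    show "isometric_family (cverts (block D ?G)) (crel (block D ?G)) fst (crel (block D' ?H)) fst
        (\<lambda>x. (D', \<psi> (snd x))) (\<lambda>x. A (\<beta> (snd x))) (\<lambda>x y. c (\<beta> (snd x)) (\<beta> (snd y)))"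
      unfolding isometric_family_def
    proof (intro conjI ballI impI allI)
      fix x assume "x \<in> cverts (block D ?G)"
      then show "c (\<beta> (snd x)) (\<beta> (snd x)) = 1"
        using iso \<beta>X D by (auto simp: cverts_block \<beta>(3) isometric_family_def)
    next
      fix x y k k'
      assume x: "x \<in> cverts (block D ?G)" and y: "y \<in> cverts (block D ?G)"
        and rel: "crel (block D' ?H) (D', \<psi> (snd x)) (D', \<psi> (snd y))" and k: "k < fst x" "k' < fst y"
      obtain i j where ij: "x = (D, i)" "i < card X" "y = (D, j)" "j < card X"
        using x y D by (auto simp: cverts_block \<beta>(3))
      have "S (\<phi> (\<beta> i)) (\<phi> (\<beta> j))"
        using rel ij D \<psi> \<delta>(2)[of "\<psi> i" "\<psi> j"] by (simp add: crel_block)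
      then have "(\<Sum>l<D'. cnj (A (\<beta> i) l k) * A (\<beta> j) l k')
          = (if R (\<beta> i) (\<beta> j) \<and> k = k' then c (\<beta> i) (\<beta> j) else 0)"
        using iso \<beta>X ij k unfolding isometric_family_def by simp
      then show "(\<Sum>l<fst (D', \<psi> (snd x)). cnj (A (\<beta> (snd x)) l k) * A (\<beta> (snd y)) l k')
          = (if crel (block D ?G) x y \<and> k = k' then c (\<beta> (snd x)) (\<beta> (snd y)) else 0)"
        using ij D \<beta>(2)[of i j] by (simp add: crel_block)
    qed
  qed
  then have "falpha f \<alpha> (block D ?G) \<le> falpha f \<alpha> (block D' ?H)"
    by (rule DeltaA_mono[OF mono wf_block[OF \<beta>(4)] wf_block[OF \<delta>(4)]])
  then show ?thesis
    by (simp only: falpha_block[OF f D(1)] falpha_block[OF f D(2)] gval_def)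
qed

definition pushfwd :: "'a set \<Rightarrow> ('a \<Rightarrow> 'b) \<Rightarrow> ('a \<Rightarrow> nat) \<Rightarrow> 'b \<Rightarrow> nat" where
  "pushfwd V \<phi> a w = (\<Sum>v | v \<in> V \<and> \<phi> v = w. a v)"

lemma sum_pushfwd: "finite V \<Longrightarrow> sum (pushfwd V \<phi> a) (\<phi> ` V) = sum a V"
  unfolding pushfwd_def by (rule sum.image_gen[symmetric])

lemma map_tclass:
  assumes V: "finite V" and xs: "xs \<in> tclass V a"
  shows "map \<phi> xs \<in> tclass (\<phi> ` V) (pushfwd V \<phi> a)"
proof -
  have "count_list (map \<phi> xs) w = (\<Sum>v | v \<in> V \<and> \<phi> v = w. count_list xs v)" if "set xs \<subseteq> V" for w
    using that
  proof (induction xs)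
    case (Cons x xs)
    have "(\<Sum>v | v \<in> V \<and> \<phi> v = w. count_list (x # xs) v)
        = (\<Sum>v | v \<in> V \<and> \<phi> v = w. (if v = x then 1 else 0) + count_list xs v)"
      by (intro sum.cong) auto
    also have "\<dots> = (if \<phi> x = w then 1 else 0) + (\<Sum>v | v \<in> V \<and> \<phi> v = w. count_list xs v)"
      using Cons.prems V by (simp add: sum.distrib)
    finally show ?case using Cons by simp
  qed simp
  then show ?thesis
    using xs unfolding tclass_def pushfwd_def by (auto intro!: sum.cong)
qed

text \<open>On one type class all Kronecker products have the same format, \<open>?D'\<close> rows
  and \<open>?D\<close> columns, so the tensor power becomes an isometric family with constant
  dimensions. Taking the image of \<open>V\<close> as target keeps the pushed-forward counts
  positive.\<close>

lemma isometric_family_tval_le: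
  assumes f: "DeltaG f" and mono: "DeltaA (falpha f \<alpha>)"
    and V: "finite V" "reflp R" "symp R" and S: "reflp S" "symp S"
    and d: "\<And>x y. R x y \<Longrightarrow> d x = d y" "\<And>v. v \<in> V \<Longrightarrow> 1 \<le> d v"
    and e: "\<And>x y. S x y \<Longrightarrow> e x = e y" "\<And>v. v \<in> V \<Longrightarrow> 1 \<le> e (\<phi> v)"
    and iso: "isometric_family V R d S e \<phi> A c"
  shows "tval f V R a * real (\<Prod>v\<in>V. d v ^ a v) powr \<alpha>
    \<le> tval f (\<phi> ` V) S (pushfwd V \<phi> a) * real (\<Prod>w\<in>\<phi> ` V. e w ^ pushfwd V \<phi> a w) powr \<alpha>"
  unfolding tval_def
proof (rule isometric_family_gval_le[OF f mono, where \<phi> = "map \<phi>" and A = "tensor (e \<circ> \<phi>) d A"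
      and c = "\<lambda>xs ys. prod_list (map2 c xs ys)"])
  let ?D = "\<Prod>v\<in>V. d v ^ a v" and ?D' = "\<Prod>w\<in>\<phi> ` V. e w ^ pushfwd V \<phi> a w"
  show "1 \<le> ?D" "1 \<le> ?D'"
    by (intro prod_ge_1 one_le_power; use d(2) e(2) in auto)+
  show "map \<phi> ` tclass V a \<subseteq> tclass (\<phi> ` V) (pushfwd V \<phi> a)"
    using map_tclass[OF V(1)] by blast
  have D: "prod_list (map d xs) = ?D" "prod_list (map (e \<circ> \<phi>) xs) = ?D'" if "xs \<in> tclass V a" for xs
    using prod_list_tclass[OF V(1) that] prod_list_tclass[OF _ map_tclass[OF V(1) that, of \<phi>], of e] V(1)
    by simp_all
  show "isometric_family (tclass V a) (list_all2 R) (\<lambda>_. ?D) (list_all2 S) (\<lambda>_. ?D') (map \<phi>)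
      (tensor (e \<circ> \<phi>) d A) (\<lambda>xs ys. prod_list (map2 c xs ys))"
    unfolding isometric_family_def
  proof (intro conjI ballI impI allI)
    fix xs assume "xs \<in> tclass V a"
    then have "\<forall>x\<in>set xs. c x x = 1" using iso by (auto simp: isometric_family_def tclass_def)
    then show "prod_list (map2 c xs xs) = 1" by (induction xs) auto
  next
    fix xs ys k k' assume h: "xs \<in> tclass V a" "ys \<in> tclass V a"
      "list_all2 S (map \<phi> xs) (map \<phi> ys)" "k < ?D" "k' < ?D"
    show "(\<Sum>l<?D'. cnj (tensor (e \<circ> \<phi>) d A xs l k) * tensor (e \<circ> \<phi>) d A ys l k')
        = (if list_all2 R xs ys \<and> k = k' then prod_list (map2 c xs ys) else 0)"
      using tensor_gram[OF iso d(1) e(1), of xs ys k k'] h D[of xs] D[of ys]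
      by (simp add: list.rel_map tclass_def)
  qed
qed (use V S in \<open>auto intro!: finite_tclass list.rel_reflp list.rel_symp\<close>)

section \<open>Convexity\<close>

lemma tclass_cong: "(\<And>v. v \<in> V \<Longrightarrow> a v = b v) \<Longrightarrow> tclass V a = tclass V b"
  by (auto simp: tclass_def)

lemma pushfwd_inj:
  assumes "inj_on \<phi> V" "v \<in> V"
  shows "pushfwd V \<phi> a (\<phi> v) = a v"
proof -
  have "{v'. v' \<in> V \<and> \<phi> v' = \<phi> v} = {v}" using assms by (auto simp: inj_on_def)
  then show ?thesis by (simp add: pushfwd_def)
qed

lemma tval_bij_le:
  assumes f: "DeltaG f" and U: "finite U" "reflp Q" "symp Q" and R: "reflp R" "symp R"
    and \<beta>: "bij_betw \<beta> U V" "\<And>x y. x \<in> U \<Longrightarrow> y \<in> U \<Longrightarrow> R (\<beta> x) (\<beta> y) \<Longrightarrow> Q x y"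
    and b: "\<And>u. u \<in> U \<Longrightarrow> b u = a (\<beta> u)"
  shows "tval f U Q b \<le> tval f V R a"
  unfolding tval_def
proof (rule gval_mono[where \<phi> = "map \<beta>"])
  have V: "\<beta> ` U = V" "inj_on \<beta> U" using \<beta>(1) by (auto simp: bij_betw_def)
  have "tclass (\<beta> ` U) (pushfwd U \<beta> b) = tclass V a"
    unfolding V(1) by (rule tclass_cong) (use V b in \<open>auto simp: pushfwd_inj\<close>)
  then show "map \<beta> ` tclass U b \<subseteq> tclass V a"
    using map_tclass[OF U(1), of _ b \<beta>] by blast
  show "finite (tclass V a)" using U(1) V(1) by (auto intro: finite_tclass)
  fix xs ys assume "xs \<in> tclass U b" "ys \<in> tclass U b" "list_all2 R (map \<beta> xs) (map \<beta> ys)"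
  then show "list_all2 Q xs ys"
    using \<beta>(2) by (auto simp: tclass_def list_all2_conv_all_nth subset_iff)
qed (use f U R in \<open>auto intro!: finite_tclass list.rel_reflp list.rel_symp\<close>)

lemma tval_bij:
  assumes f: "DeltaG f" and U: "finite U" "reflp Q" "symp Q" and R: "reflp R" "symp R"
    and \<beta>: "bij_betw \<beta> U V" "\<And>x y. x \<in> U \<Longrightarrow> y \<in> U \<Longrightarrow> Q x y \<longleftrightarrow> R (\<beta> x) (\<beta> y)"
  shows "tval f U Q (\<lambda>u. a (\<beta> u)) = tval f V R a"
proof (rule antisym)
  show "tval f U Q (\<lambda>u. a (\<beta> u)) \<le> tval f V R a"
    using assms by (intro tval_bij_le) auto
  let ?\<beta>' = "inv_into U \<beta>"
  have inv: "?\<beta>' v \<in> U" "\<beta> (?\<beta>' v) = v" if "v \<in> V" for v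
    using that \<beta>(1) by (auto simp: bij_betw_def inv_into_into f_inv_into_f)
  show "tval f V R a \<le> tval f U Q (\<lambda>u. a (\<beta> u))"
  proof (rule tval_bij_le[OF f _ R U(2,3) bij_betw_inv_into[OF \<beta>(1)]])
    show "finite V" using \<beta>(1) U(1) bij_betw_finite by blast
    fix x y assume "x \<in> V" "y \<in> V" "Q (?\<beta>' x) (?\<beta>' y)"
    then show "R x y" using \<beta>(2)[of "?\<beta>' x" "?\<beta>' y"] inv by simp
  qed (simp add: inv)
qed

text \<open>The growth rate of \<open>tval\<close> is, up to normalisation, the logarithm of the probabilistic
  refinement; hence the assumption on \<open>h\<close> is an identity between growth rates.\<close>
lemma growth_rate_convex:
  assumes f: "DeltaG f" and g: "DeltaG g" and h: "DeltaG h"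
    and conv: "\<forall>G P. wf_graph G \<longrightarrow> nv G > 0 \<longrightarrow> pdist (nv G) P \<longrightarrow>
           ln (prob_ref h G P) = lam * ln (prob_ref f G P) + (1 - lam) * ln (prob_ref g G P)"
    and V: "finite V" "V \<noteq> {}" and R: "reflp R" "symp R" and a: "\<And>v. v \<in> V \<Longrightarrow> 0 < a v"
    and lf: "(\<lambda>m. ln (tval f V R (\<lambda>v. m * a v)) / real m) \<longlonglongrightarrow> lf"
    and lg: "(\<lambda>m. ln (tval g V R (\<lambda>v. m * a v)) / real m) \<longlonglongrightarrow> lg"
    and lh: "(\<lambda>m. ln (tval h V R (\<lambda>v. m * a v)) / real m) \<longlonglongrightarrow> lh"
  shows "lh = lam * lf + (1 - lam) * lg"
proof -
  let ?G = "canon V (\<lambda>x y. x \<noteq> y \<and> R x y)"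
  obtain \<beta> where \<beta>: "bij_betw \<beta> {0..<card V} V"
    "\<And>i j. i < card V \<Longrightarrow> j < card V \<Longrightarrow> simeq ?G i j \<longleftrightarrow> R (\<beta> i) (\<beta> j)"
    "nv ?G = card V" "wf_graph ?G"
    using canon_presentation[OF V(1) R] by blast
  define N where "N = sum a V"
  have N0: "0 < N" unfolding N_def using a V by (intro sum_pos) auto
  have pos: "0 < a (\<beta> i)" if "i < nv ?G" for i
    using \<beta>(1,3) that by (intro a) (auto simp: bij_betw_def)
  have N: "(\<Sum>i<nv ?G. a (\<beta> i)) = N"
    unfolding N_def \<beta>(3) using sum.reindex_bij_betw[OF \<beta>(1)] by (simp add: atLeast0LessThan)
  define P where "P i = real (a (\<beta> i)) / real N" for i
  have "pdist (nv ?G) P"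
    using N N0 by (simp add: pdist_def P_def flip: sum_divide_distrib of_nat_sum)
  moreover have "nv ?G > 0" using V by (simp add: \<beta>(3) card_gt_0_iff)
  ultimately have eq: "ln (prob_ref h ?G P) = lam * ln (prob_ref f ?G P) + (1 - lam) * ln (prob_ref g ?G P)"
    using conv \<beta>(4) by blast
  have "ln (prob_ref F ?G P) = l / real N"
    if F: "DeltaG F" and l: "(\<lambda>m. ln (tval F V R (\<lambda>v. m * a v)) / real m) \<longlonglongrightarrow> l" for F l
  proof -
    have tr: "tval F {0..<nv ?G} (simeq ?G) (\<lambda>i. m * a (\<beta> i)) = tval F V R (\<lambda>v. m * a v)" for m
      using tval_bij[OF F _ reflp_simeq symp_simeq[OF \<beta>(4)] R \<beta>(1), of "\<lambda>v. m * a v"] \<beta>(2,3) by simp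
    \<comment> \<open>The rate is obtained anew together with its bound for every m, then identified
      with \<open>l\<close> by uniqueness of limits.\<close>
    obtain l' where l': "(\<lambda>m. ln (tval F V R (\<lambda>v. m * a v)) / real m) \<longlonglongrightarrow> l'"
      "\<And>m. ln (tval F V R (\<lambda>v. m * a v)) \<le> real m * l'" "0 \<le> l'"
      using tval_growth_rate[OF F V(1) R] by blast
    have "l' = l" using l' l LIMSEQ_unique by blast
    then show ?thesis
      unfolding P_def using l'
      by (intro ln_prob_ref[OF F \<beta>(4) _ N N0]) (simp_all only: tr pos)
  qed
  from this[OF f lf] this[OF g lg] this[OF h lh] eq N0
  show ?thesis by (simp add: field_simps)
qed

section \<open>Comparison of f_\<alpha> through types\<close>

lemma wval_mono_subset:
  assumes f: "DeltaG f" and V: "finite V" "W \<subseteq> V" and R: "reflp R" "symp R"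
    and \<omega>: "\<And>c. 0 \<le> \<omega> c"
  shows "wval f W R clr \<omega> \<le> wval f V R clr \<omega>"
proof -
  have "wval f W R clr \<omega> \<le> (\<Sum>c\<in>clr ` W. gval f {x\<in>V. clr x = c} R * \<omega> c)"
    unfolding wval_def using f V R \<omega> by (intro sum_mono mult_right_mono gval_subset) auto
  also have "\<dots> \<le> wval f V R clr \<omega>"
    unfolding wval_def using f V R \<omega> by (intro sum_mono2 mult_nonneg_nonneg gval_nonneg) auto
  finally show ?thesis .
qed

lemma falpha_nonneg:
  assumes "DeltaG f" "wf_rep Gs"
  shows "0 \<le> falpha f \<alpha> Gs"
  using assms unfolding falpha_def wf_rep_def
  by (intro sum_nonneg mult_nonneg_nonneg) (auto intro: DeltaG_nonneg)

lemma falpha_wval: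
  assumes f: "DeltaG f" and Gs: "wf_rep Gs"
  shows "falpha f \<alpha> Gs = wval f (cverts Gs) (crel Gs) fst (\<lambda>d. real d powr \<alpha>)"
proof -
  have "gval f {x\<in>cverts Gs. fst x = d} (crel Gs) = f (gr Gs d)" if d: "d \<in> {1..length Gs}" for d
  proof (rule gval_eq[OF f _ reflp_crel symp_crel[OF Gs]])
    have "bij_betw (Pair d) {0..<nv (gr Gs d)} {x\<in>cverts Gs. fst x = d}"
      using d by (auto simp: bij_betw_def inj_on_def cverts_def)
    then show "presents (gr Gs d) {x\<in>cverts Gs. fst x = d} (crel Gs)"
      unfolding presents_def using wf_gr[OF Gs, of d]
      by (intro conjI exI[of _ "Pair d"]) (auto simp: crel_def)
  qed (simp add: finite_cverts)
  then have "falpha f \<alpha> Gs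
      = (\<Sum>d\<in>{1..length Gs}. gval f {x\<in>cverts Gs. fst x = d} (crel Gs) * real d powr \<alpha>)"
    by (simp add: falpha_conv_gr[OF f order_refl])
  also have "\<dots> = wval f (cverts Gs) (crel Gs) fst (\<lambda>d. real d powr \<alpha>)"
    unfolding wval_def
  proof (rule sum.mono_neutral_right)
    show "\<forall>d\<in>{1..length Gs} - fst ` cverts Gs.
        gval f {x\<in>cverts Gs. fst x = d} (crel Gs) * real d powr \<alpha> = 0"
    proof
      fix d assume "d \<in> {1..length Gs} - fst ` cverts Gs"
      then have "{x\<in>cverts Gs. fst x = d} = {}" by blast
      then show "gval f {x\<in>cverts Gs. fst x = d} (crel Gs) * real d powr \<alpha> = 0"
        using gval_empty[OF f reflp_crel symp_crel[OF Gs]] by (simp only: mult_zero_left)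
    qed
  qed (auto simp: cverts_def)
  finally show ?thesis .
qed

lemma prod_power_powr:
  fixes d :: "'a \<Rightarrow> nat"
  shows "(\<Prod>v\<in>V. (real (d v) powr \<gamma>) ^ a v) = real (\<Prod>v\<in>V. d v ^ a v) powr \<gamma>"
proof -
  have "(real m powr \<gamma>) ^ k = real (m ^ k) powr \<gamma>" for m k
    by (induction k) (simp_all add: powr_mult)
  then show ?thesis by (simp add: prod_powr_distrib)
qed

text \<open>After taking logarithms and dividing by n, the polynomial factor and the k extra powers
  tend to 0.\<close>

lemma le_of_subexponential:
  fixes x w :: real
  assumes x: "0 \<le> x" and w: "0 < w" and le: "\<And>n. x ^ n \<le> (real n + 1) ^ k * w ^ (n + k)"
  shows "x \<le> w"
proof (rule ccontr)
  assume "\<not> x \<le> w"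
  then have xw: "w < x" by simp
  define \<delta> where "\<delta> = ln x - ln w"
  have \<delta>: "\<delta> > 0" using xw w by (simp add: \<delta>_def)
  have "\<delta> - \<delta> * (1 / real n) \<le> real k * (ln (real n) / real n) + real k * ln w * (1 / real n)" if n: "n \<ge> 1" for n
  proof -
    \<comment> \<open>Taken at n - 1, the polynomial factor is n^k, and the known limit of ln n / n
      applies directly.\<close>
    have "x ^ (n - 1) \<le> (real n) ^ k * w ^ (n - 1 + k)"
      using le[of "n - 1"] n by (simp add: of_nat_diff)
    then have "ln (x ^ (n - 1)) \<le> ln ((real n) ^ k * w ^ (n - 1 + k))"
      using xw w by (intro ln_mono) auto
    then have "(real n - 1) * ln x \<le> real k * ln (real n) + (real n + real k - 1) * ln w"
      using xw w n by (simp add: ln_mult ln_realpow of_nat_diff)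
    then have "real n * \<delta> - \<delta> \<le> real k * ln (real n) + real k * ln w"
      by (simp add: \<delta>_def algebra_simps)
    then have "(real n * \<delta> - \<delta>) / real n \<le> (real k * ln (real n) + real k * ln w) / real n"
      by (intro divide_right_mono) auto
    then show ?thesis using n by (simp add: diff_divide_distrib add_divide_distrib)
  qed
  then have "\<delta> - \<delta> * 0 \<le> real k * 0 + real k * ln w * 0"
    by (intro LIMSEQ_le[OF tendsto_diff[OF tendsto_const tendsto_mult[OF tendsto_const lim_1_over_n]]
          tendsto_add[OF tendsto_mult[OF tendsto_const filterlim_compose[OF ln_x_over_x_tendsto_0 filterlim_real_sequentially]]
            tendsto_mult[OF tendsto_const lim_1_over_n]]]) blast
  then show False using \<delta> by simp
qed

context
  fixes f g h :: "graph \<Rightarrow> real" and \<alpha> \<beta> lam \<gamma> :: real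
  assumes f: "DeltaG f" and g: "DeltaG g" and h: "DeltaG h"
    and ab: "\<alpha> \<ge> 1" "\<beta> \<ge> 1"
    and Af: "DeltaA (falpha f \<alpha>)" and Ag: "DeltaA (falpha g \<beta>)"
    and lam: "0 \<le> lam" "lam \<le> 1"
    and conv: "\<forall>G P. wf_graph G \<longrightarrow> nv G > 0 \<longrightarrow> pdist (nv G) P \<longrightarrow>
           ln (prob_ref h G P) = lam * ln (prob_ref f G P) + (1 - lam) * ln (prob_ref g G P)"
    and \<gamma>: "\<gamma> = lam * \<alpha> + (1 - lam) * \<beta>"
begin

lemma gamma_nonneg: "0 \<le> \<gamma>"
  unfolding \<gamma> using ab lam by (intro add_nonneg_nonneg mult_nonneg_nonneg) auto

text \<open>One pushed-forward type \<open>b\<close> serves f and g alike, so their rate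
  inequalities can be averaged into one for h. On the target side the rate is bounded by powers of
  h_\<gamma>(S); on the source side Fekete's bound returns from the rate to the type
  \<open>a\<close> itself.\<close>

lemma tval_le_falpha_power:
  assumes wf: "wf_rep Ts" "wf_rep Ss" and le: "ncg_le Ts Ss" and ne: "cverts Ts \<noteq> {}"
    and a: "\<And>v. v \<in> cverts Ts \<Longrightarrow> 0 < a v"
  shows "0 < falpha h \<gamma> Ss"
    and "tval h (cverts Ts) (crel Ts) a * real (\<Prod>v\<in>cverts Ts. fst v ^ a v) powr \<gamma>
      \<le> falpha h \<gamma> Ss ^ sum a (cverts Ts)"
proof -
  obtain \<phi> A c where \<phi>: "\<phi> ` cverts Ts \<subseteq> cverts Ss"
    and iso: "isometric_family (cverts Ts) (crel Ts) fst (crel Ss) fst \<phi> A c"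
    using ncg_leE[OF le] by blast
  define V where "V = cverts Ts"
  define W where "W = \<phi> ` V"
  define b where "b = pushfwd V \<phi> a"
  define N where "N = sum a V"
  define D where "D = (\<Prod>v\<in>V. fst v ^ a v)"
  define D' where "D' = (\<Prod>w\<in>W. fst w ^ b w)"
  define wv where "wv = falpha h \<gamma> Ss"
  note T = reflp_crel[of Ts] symp_crel[OF wf(1)] and S = reflp_crel[of Ss] symp_crel[OF wf(2)]
  have V: "finite V" "V \<noteq> {}" using ne by (simp_all add: V_def finite_cverts)
  have W: "finite W" "W \<noteq> {}" "W \<subseteq> cverts Ss" using V \<phi> by (auto simp: W_def V_def)
  have dV: "1 \<le> fst v" if "v \<in> V" for v using that by (auto simp: V_def cverts_def)
  have dW: "1 \<le> fst w" if "w \<in> W" for w using that W(3) by (auto simp: cverts_def)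
  have dW': "1 \<le> fst (\<phi> v)" if "v \<in> V" for v using that dW by (simp add: W_def)
  have D1: "1 \<le> D" "1 \<le> D'"
    unfolding D_def D'_def by (intro prod_ge_1 one_le_power dV dW; assumption)+
  have apos: "0 < a v" if "v \<in> V" for v using a that by (simp add: V_def)
  \<comment> \<open>Full support on the image is what allows the convexity of growth rates to be
    used on the target side too.\<close>
  have bpos: "0 < b w" if w: "w \<in> W" for w
  proof -
    obtain v where "v \<in> V" "\<phi> v = w" using w by (auto simp: W_def)
    then show ?thesis
      unfolding b_def pushfwd_def using V(1) apos by (intro sum_pos2[of _ v]) auto
  qed
  have push: "pushfwd V \<phi> (\<lambda>v. m * a v) = (\<lambda>w. m * b w)" for m
    by (simp add: fun_eq_iff pushfwd_def b_def sum_distrib_left)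
  have Dm: "(\<Prod>v\<in>V. fst v ^ (m * a v)) = D ^ m" "(\<Prod>w\<in>W. fst w ^ (m * b w)) = D' ^ m" for m
    by (simp_all add: D_def D'_def prod_power_distrib power_mult mult.commute flip: power_mult)
  have N0: "0 < N" unfolding N_def using V apos by (intro sum_pos) auto
  have bN: "sum b W = N" by (simp add: b_def W_def N_def sum_pushfwd V(1))
  \<comment> \<open>The dimension of the type m * a is D^m, so dimensions enter the rates as
    constants, independent of m and of the functional.\<close>
  have rate: "lT + \<theta> * ln (real D) \<le> lS + \<theta> * ln (real D')"
    if F: "DeltaG F" and AF: "DeltaA (falpha F \<theta>)"
      and lT: "(\<lambda>m. ln (tval F V (crel Ts) (\<lambda>v. m * a v)) / real m) \<longlonglongrightarrow> lT"
      and lS: "(\<lambda>m. ln (tval F W (crel Ss) (\<lambda>w. m * b w)) / real m) \<longlonglongrightarrow> lS" for F \<theta> lT lS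
  proof -
    have "ln (tval F V (crel Ts) (\<lambda>v. m * a v)) / real m + \<theta> * ln (real D)
        \<le> ln (tval F W (crel Ss) (\<lambda>w. m * b w)) / real m + \<theta> * ln (real D')" if m: "m \<ge> 1" for m
    proof -
      let ?t = "tval F V (crel Ts) (\<lambda>v. m * a v)" and ?s = "tval F W (crel Ss) (\<lambda>w. m * b w)"
      have pos: "0 < ?t" "0 < ?s" using tval_pos[OF F V(1) T] tval_pos[OF F W(1) S] by auto
      have "?t * real (D ^ m) powr \<theta> \<le> ?s * real (D' ^ m) powr \<theta>"
        using isometric_family_tval_le[OF F AF V(1) T S crel_fst[where Gs = Ts] dV crel_fst[where Gs = Ss]
            dW' iso[folded V_def], where a = "\<lambda>v. m * a v"]
        unfolding push Dm W_def[symmetric] .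
      then have "ln (?t * real (D ^ m) powr \<theta>) \<le> ln (?s * real (D' ^ m) powr \<theta>)"
        using pos D1 by (intro ln_mono) auto
      then have "ln ?t + real m * (\<theta> * ln (real D)) \<le> ln ?s + real m * (\<theta> * ln (real D'))"
        using pos D1 by (simp add: ln_mult ln_powr ln_realpow algebra_simps)
      then have "(ln ?t + real m * (\<theta> * ln (real D))) / real m \<le> (ln ?s + real m * (\<theta> * ln (real D'))) / real m"
        by (intro divide_right_mono) auto
      then show ?thesis using m by (simp add: add_divide_distrib)
    qed
    then show ?thesis
      by (intro LIMSEQ_le[OF tendsto_add[OF lT tendsto_const] tendsto_add[OF lS tendsto_const]]) blast
  qed
  obtain lfT where lfT: "(\<lambda>m. ln (tval f V (crel Ts) (\<lambda>v. m * a v)) / real m) \<longlonglongrightarrow> lfT"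
    using tval_growth_rate[OF f V(1) T] by blast
  obtain lgT where lgT: "(\<lambda>m. ln (tval g V (crel Ts) (\<lambda>v. m * a v)) / real m) \<longlonglongrightarrow> lgT"
    using tval_growth_rate[OF g V(1) T] by blast
  obtain lhT where lhT: "(\<lambda>m. ln (tval h V (crel Ts) (\<lambda>v. m * a v)) / real m) \<longlonglongrightarrow> lhT"
    "\<And>m. ln (tval h V (crel Ts) (\<lambda>v. m * a v)) \<le> real m * lhT"
    using tval_growth_rate[OF h V(1) T] by blast
  obtain lfS where lfS: "(\<lambda>m. ln (tval f W (crel Ss) (\<lambda>w. m * b w)) / real m) \<longlonglongrightarrow> lfS"
    using tval_growth_rate[OF f W(1) S] by blast
  obtain lgS where lgS: "(\<lambda>m. ln (tval g W (crel Ss) (\<lambda>w. m * b w)) / real m) \<longlonglongrightarrow> lgS"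
    using tval_growth_rate[OF g W(1) S] by blast
  obtain lhS where lhS: "(\<lambda>m. ln (tval h W (crel Ss) (\<lambda>w. m * b w)) / real m) \<longlonglongrightarrow> lhS"
    using tval_growth_rate[OF h W(1) S] by blast
  have hT: "lhT = lam * lfT + (1 - lam) * lgT"
    by (rule growth_rate_convex[OF f g h conv V T apos lfT lgT lhT(1)])
  have hS: "lhS = lam * lfS + (1 - lam) * lgS"
    by (rule growth_rate_convex[OF f g h conv W(1,2) S bpos lfS lgS lhS])
  have rate_h: "lhT + \<gamma> * ln (real D) \<le> lhS + \<gamma> * ln (real D')"
  proof -
    \<comment> \<open>Since \<open>D\<close> and \<open>D'\<close> are common to both inequalities,
      averaging with nonnegative weights also averages the exponents, producing \<gamma>.\<close>
    have "lam * (lfT + \<alpha> * ln (real D)) + (1 - lam) * (lgT + \<beta> * ln (real D))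
        \<le> lam * (lfS + \<alpha> * ln (real D')) + (1 - lam) * (lgS + \<beta> * ln (real D'))"
      using rate[OF f Af lfT lfS] rate[OF g Ag lgT lgS] lam
      by (intro add_mono[OF mult_left_mono mult_left_mono]) auto
    then show ?thesis unfolding hT hS \<gamma> by (simp add: algebra_simps)
  qed
  have wv0: "0 \<le> wv"
    unfolding wv_def by (rule falpha_nonneg[OF h wf(2)])
  have bound: "tval h W (crel Ss) (\<lambda>w. m * b w) * real (D' ^ m) powr \<gamma> \<le> wv ^ (m * N)" for m
  proof -
    have "tval h W (crel Ss) (\<lambda>w. m * b w) * real (D' ^ m) powr \<gamma>
        \<le> wval h W (crel Ss) fst (\<lambda>d. real d powr \<gamma>) ^ (m * N)"
      using tval_le_wval_power[OF h W(1) S, of fst "\<lambda>d. real d powr \<gamma>" "\<lambda>w. m * b w"]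
      unfolding prod_power_powr Dm by (simp add: crel_def bN flip: sum_distrib_left)
    also have "\<dots> \<le> wv ^ (m * N)"
      unfolding wv_def falpha_wval[OF h wf(2)]
    proof (rule power_mono)
      show "wval h W (crel Ss) fst (\<lambda>d. real d powr \<gamma>) \<le> wval h (cverts Ss) (crel Ss) fst (\<lambda>d. real d powr \<gamma>)"
        by (rule wval_mono_subset[OF h finite_cverts W(3) S]) simp
      show "0 \<le> wval h W (crel Ss) fst (\<lambda>d. real d powr \<gamma>)"
        unfolding wval_def using gval_nonneg[OF h _ S] W(1)
        by (intro sum_nonneg mult_nonneg_nonneg) auto
    qed
    finally show ?thesis .
  qed
  have posS: "0 < tval h W (crel Ss) (\<lambda>w. m * b w) * real (D' ^ m) powr \<gamma>" for m
    using tval_pos[OF h W(1) S] D1 by simp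
  have "0 < wv ^ (1 * N)" using posS bound less_le_trans by blast
  then have wv: "0 < wv" using wv0 N0 by (cases "wv = 0") (auto simp: zero_power)
  then show "0 < falpha h \<gamma> Ss" by (simp add: wv_def)
  have "ln (tval h W (crel Ss) (\<lambda>w. m * b w)) / real m + \<gamma> * ln (real D') \<le> real N * ln wv" if m: "m \<ge> 1" for m
  proof -
    have "ln (tval h W (crel Ss) (\<lambda>w. m * b w) * real (D' ^ m) powr \<gamma>) \<le> ln (wv ^ (m * N))"
      using posS bound by (rule ln_mono[rotated])
    then have "ln (tval h W (crel Ss) (\<lambda>w. m * b w)) + real m * (\<gamma> * ln (real D')) \<le> real m * (real N * ln wv)"
      using tval_pos[OF h W(1) S, of "\<lambda>w. m * b w"] D1 wv
      by (simp add: ln_mult ln_powr ln_realpow algebra_simps)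
    then have "(ln (tval h W (crel Ss) (\<lambda>w. m * b w)) + real m * (\<gamma> * ln (real D'))) / real m
        \<le> real m * (real N * ln wv) / real m"
      by (intro divide_right_mono) auto
    then show ?thesis using m by (simp add: add_divide_distrib)
  qed
  then have "lhS + \<gamma> * ln (real D') \<le> real N * ln wv"
    by (intro LIMSEQ_le_const2[OF tendsto_add[OF lhS tendsto_const]]) blast
  \<comment> \<open>The case m = 1 of the Fekete bound, which makes the conclusion exact rather than
    asymptotic.\<close>
  moreover have "ln (tval h V (crel Ts) a) \<le> lhT"
    using lhT(2)[of 1] by simp
  ultimately have "ln (tval h V (crel Ts) a) + \<gamma> * ln (real D) \<le> real N * ln wv"
    using rate_h by linarith
  then have "ln (tval h V (crel Ts) a * real D powr \<gamma>) \<le> ln (wv ^ N)"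
    using tval_pos[OF h V(1) T, of a] D1 wv by (simp add: ln_mult ln_powr ln_realpow)
  then have "tval h V (crel Ts) a * real D powr \<gamma> \<le> wv ^ N"
    using tval_pos[OF h V(1) T, of a] D1 wv by (simp add: ln_le_cancel_iff)
  then show "tval h (cverts Ts) (crel Ts) a * real (\<Prod>v\<in>cverts Ts. fst v ^ a v) powr \<gamma>
      \<le> falpha h \<gamma> Ss ^ sum a (cverts Ts)"
    by (simp add: V_def D_def wv_def N_def)
qed

text \<open>The bound for single types requires positive counts, while types of length n may omit
  vertices. Raising every count by 1 repairs this and lengthens the type by the number k of
  vertices; the number of types is at most (n + 1)^k.\<close>

lemma falpha_mono:
  assumes wf: "wf_rep Ts" "wf_rep Ss" and le: "ncg_le Ts Ss"
  shows "falpha h \<gamma> Ts \<le> falpha h \<gamma> Ss"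
proof (cases "cverts Ts = {}")
  case True
  then show ?thesis
    using falpha_nonneg[OF h wf(2), of \<gamma>] by (simp add: falpha_wval[OF h wf(1)] wval_def)
next
  case False
  define V where "V = cverts Ts"
  define k where "k = card V"
  note T = reflp_crel[of Ts] symp_crel[OF wf(1)]
  have V: "finite V" by (simp add: V_def finite_cverts)
  have dV: "1 \<le> fst v" if "v \<in> V" for v using that by (auto simp: V_def cverts_def)
  note key = tval_le_falpha_power[OF wf le False, folded V_def]
  have w: "0 < falpha h \<gamma> Ss" using key(1)[of "\<lambda>_. 1"] by simp
  have "falpha h \<gamma> Ts ^ n \<le> (real n + 1) ^ k * falpha h \<gamma> Ss ^ (n + k)" for n
  proof -
    let ?T = "{a. a \<in> PiE V (\<lambda>_. {0..n}) \<and> sum a V = n}"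
    have "falpha h \<gamma> Ts ^ n \<le> (\<Sum>a\<in>?T. tval h V (crel Ts) a * (\<Prod>v\<in>V. (real (fst v) powr \<gamma>) ^ a v))"
      unfolding falpha_wval[OF h wf(1)] V_def[symmetric]
      by (rule wval_power_le_tval[OF h V T]) (auto simp: crel_def)
    also have "\<dots> \<le> (\<Sum>a\<in>?T. falpha h \<gamma> Ss ^ (n + k))"
    proof (rule sum_mono)
      fix a assume a: "a \<in> ?T"
      \<comment> \<open>Both factors grow under the shift: the type class by padding, the dimension
        because fibre dimensions are at least 1 and \<gamma> is nonnegative.\<close>
      have "tval h V (crel Ts) a * (\<Prod>v\<in>V. (real (fst v) powr \<gamma>) ^ a v)
          \<le> tval h V (crel Ts) (\<lambda>v. a v + 1) * real (\<Prod>v\<in>V. fst v ^ (a v + 1)) powr \<gamma>"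
        unfolding prod_power_powr
      proof (intro mult_mono powr_mono2 gamma_nonneg tval_mono[OF h V T])
        have "(\<Prod>v\<in>V. fst v ^ a v) \<le> (\<Prod>v\<in>V. fst v ^ (a v + 1))"
          using dV by (intro prod_mono) (auto intro!: power_increasing)
        then show "real (\<Prod>v\<in>V. fst v ^ a v) \<le> real (\<Prod>v\<in>V. fst v ^ (a v + 1))"
          by (simp only: of_nat_le_iff)
      qed (use tval_pos[OF h V T] in \<open>auto simp: less_imp_le intro!: prod_nonneg\<close>)
      also have "\<dots> \<le> falpha h \<gamma> Ss ^ sum (\<lambda>v. a v + 1) V"
        by (rule key(2)) simp
      also have "sum (\<lambda>v. a v + 1) V = n + k"
        using a by (simp only: sum.distrib) (simp add: k_def)
      finally show "tval h V (crel Ts) a * (\<Prod>v\<in>V. (real (fst v) powr \<gamma>) ^ a v) \<le> falpha h \<gamma> Ss ^ (n + k)" .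
    qed
    also have "\<dots> = real (card ?T) * falpha h \<gamma> Ss ^ (n + k)" by simp
    also have "\<dots> \<le> (real n + 1) ^ k * falpha h \<gamma> Ss ^ (n + k)"
    proof (rule mult_right_mono)
      have "card ?T \<le> card (PiE V (\<lambda>_. {0..n}))"
        using V by (intro card_mono finite_PiE) auto
      also have "\<dots> = (n + 1) ^ k" using V by (simp add: card_PiE k_def)
      finally have "real (card ?T) \<le> real ((n + 1) ^ k)" by (simp only: of_nat_le_iff)
      then show "real (card ?T) \<le> (real n + 1) ^ k" by (simp add: add.commute)
    qed (use w in simp)
    finally show ?thesis .
  qed
  then show ?thesis by (rule le_of_subexponential[OF falpha_nonneg[OF h wf(1)] w])
qed

end

section \<open>Additivity and multiplicativity of f_\<alpha>\<close>

lemma falpha_rep_add: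
  assumes f: "DeltaG f" and wf: "wf_rep Gs" "wf_rep Hs"
  shows "falpha f \<alpha> (rep_add Gs Hs) = falpha f \<alpha> Gs + falpha f \<alpha> Hs"
proof -
  let ?M = "max (length Gs) (length Hs)"
  have len: "length (rep_add Gs Hs) = ?M" by (simp add: rep_add_def del: upt_Suc)
  have gr: "gr (rep_add Gs Hs) d = dunion (gr Gs d) (gr Hs d)" if "d \<in> {1..?M}" for d
  proof -
    have "gr (rep_add Gs Hs) d = rep_add Gs Hs ! (d - 1)" using that len by (simp add: gr_def)
    also have "\<dots> = dunion (gr Gs d) (gr Hs d)"
      using that unfolding rep_add_def by (subst nth_map) (auto simp: nth_upt simp del: upt_Suc)
    finally show ?thesis .
  qed
  have "falpha f \<alpha> (rep_add Gs Hs) = (\<Sum>d\<in>{1..?M}. f (gr (rep_add Gs Hs) d) * real d powr \<alpha>)"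
    by (intro falpha_conv_gr f) (simp add: len)
  also have "\<dots> = (\<Sum>d\<in>{1..?M}. f (gr Gs d) * real d powr \<alpha> + f (gr Hs d) * real d powr \<alpha>)"
    by (intro sum.cong refl) (simp add: gr DeltaG_dunion[OF f] wf_gr wf distrib_right)
  also have "\<dots> = falpha f \<alpha> Gs + falpha f \<alpha> Hs"
    by (simp add: sum.distrib falpha_conv_gr[OF f, of _ ?M])
  finally show ?thesis .
qed

lemma wf_foldr_dunion: "(\<And>G. G \<in> set Gs \<Longrightarrow> wf_graph G) \<Longrightarrow> wf_graph (foldr dunion Gs empty_graph)"
  by (induction Gs) auto

lemma DeltaG_foldr_dunion:
  assumes "DeltaG f" "\<And>G. G \<in> set Gs \<Longrightarrow> wf_graph G"
  shows "f (foldr dunion Gs empty_graph) = (\<Sum>G\<leftarrow>Gs. f G)"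
  using assms(2) by (induction Gs) (auto simp: DeltaG_empty[OF assms(1)] DeltaG_dunion[OF assms(1)] wf_foldr_dunion)

text \<open>Pairs of blocks are grouped by the product of their dimensions; multiplicativity of
  d^\<alpha> then separates the double sum.\<close>

lemma falpha_rep_mult:
  assumes f: "DeltaG f" and wf: "wf_rep Gs" "wf_rep Hs"
  shows "falpha f \<alpha> (rep_mult Gs Hs) = falpha f \<alpha> Gs * falpha f \<alpha> Hs"
proof -
  let ?r = "length Gs" and ?s = "length Hs"
  let ?I = "{1..?r} \<times> {1..?s}"
  define t where "t p = f (gr Gs (fst p)) * f (gr Hs (snd p))" for p
  have len: "length (rep_mult Gs Hs) = ?r * ?s" by (simp add: rep_mult_def del: upt_Suc)
  have val: "f (gr (rep_mult Gs Hs) d) = (\<Sum>p | p \<in> ?I \<and> fst p * snd p = d. t p)" if d: "d \<in> {1..?r * ?s}" for d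
  proof -
    let ?L = "filter (\<lambda>(a, b). a * b = d) (List.product [1..<?r + 1] [1..<?s + 1])"
    have "gr (rep_mult Gs Hs) d = rep_mult Gs Hs ! (d - 1)" using d len by (simp add: gr_def)
    also have "\<dots> = foldr dunion (map (\<lambda>(a, b). sprod (gr Gs a) (gr Hs b)) ?L) empty_graph"
      using d unfolding rep_mult_def by (subst nth_map) (auto simp: nth_upt simp del: upt_Suc)
    finally have "f (gr (rep_mult Gs Hs) d) = (\<Sum>G\<leftarrow>map (\<lambda>(a, b). sprod (gr Gs a) (gr Hs b)) ?L. f G)"
      using wf by (simp only:) (intro DeltaG_foldr_dunion f, auto simp: wf_gr)
    also have "\<dots> = (\<Sum>p\<leftarrow>?L. t p)"
      unfolding map_map by (intro arg_cong[where f = sum_list] map_cong refl)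
        (auto simp: t_def DeltaG_sprod[OF f] wf_gr wf)
    also have "\<dots> = (\<Sum>p\<in>set ?L. t p)"
      by (intro sum_list_distinct_conv_sum_set distinct_filter distinct_product distinct_upt)
    also have "set ?L = {p. p \<in> ?I \<and> fst p * snd p = d}"
      by auto
    finally show ?thesis .
  qed
  have "falpha f \<alpha> (rep_mult Gs Hs) = (\<Sum>d\<in>{1..?r * ?s}. f (gr (rep_mult Gs Hs) d) * real d powr \<alpha>)"
    by (intro falpha_conv_gr f) (simp add: len)
  also have "\<dots> = (\<Sum>d\<in>{1..?r * ?s}. \<Sum>p | p \<in> ?I \<and> fst p * snd p = d. t p * real (fst p * snd p) powr \<alpha>)"
    by (intro sum.cong refl) (simp add: val sum_distrib_right)
  also have "\<dots> = (\<Sum>p\<in>?I. t p * real (fst p * snd p) powr \<alpha>)"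
    by (intro sum.group) (auto intro: mult_le_mono)
  also have "\<dots> = (\<Sum>p\<in>?I. (f (gr Gs (fst p)) * real (fst p) powr \<alpha>) * (f (gr Hs (snd p)) * real (snd p) powr \<alpha>))"
    by (intro sum.cong refl) (simp add: t_def powr_mult mult_ac)
  also have "\<dots> = falpha f \<alpha> Gs * falpha f \<alpha> Hs"
    by (simp add: falpha_conv_gr[OF f order_refl] sum_product sum.cartesian_product case_prod_beta)
  finally show ?thesis .
qed

theorem theorem4p2:
  fixes f g h :: "graph \<Rightarrow> real" and \<alpha> \<beta> lam \<gamma> :: real
  assumes "DeltaG f" and "DeltaG g" and "DeltaG h"
    and "\<alpha> \<ge> 1" and "\<beta> \<ge> 1"
    and "DeltaA (falpha f \<alpha>)" and "DeltaA (falpha g \<beta>)"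
    and "0 \<le> lam" and "lam \<le> 1"
    and "\<forall>G P. wf_graph G \<longrightarrow> nv G > 0 \<longrightarrow> pdist (nv G) P \<longrightarrow>
           ln (prob_ref h G P) = lam * ln (prob_ref f G P) + (1 - lam) * ln (prob_ref g G P)"
    and "\<gamma> = lam * \<alpha> + (1 - lam) * \<beta>"
  shows "DeltaA (falpha h \<gamma>)"
proof -
  \<comment> \<open>\<open>K1\<close> is the one-dimensional block, so its weight is 1^\<gamma> = 1.
    The relation between h, f and g enters through monotonicity.\<close>
  have "falpha h \<gamma> [K1] = 1" using DeltaG_K1[OF assms(3)] by (simp add: falpha_def)
  moreover have "falpha h \<gamma> [] = 0" by (simp add: falpha_def)
  ultimately show ?thesis
    unfolding DeltaA_def
    by (intro conjI allI impI falpha_nonneg falpha_rep_add falpha_rep_mult falpha_mono[OF assms])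
      (use assms(3) in simp_all)
qed

end
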